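(* Let $N\ge 11$ and let $f$ satisfy the standing assumptions given in the context. If the finite limit $q_0=\lim_{u\to 0+}f'(u)F(u)$ exists and $q_0>q_{JL}$, then $u(r,\alpha)$ is unstable for any $\alpha>0$.
   Context: Standing assumptions on $f:\mathbb{R}\to\mathbb{R}$: $f\in C^2(\mathbb{R}\setminus\{0\})\cap C^1(\mathbb{R})$; $f$ is odd (so $f(0)=0$); and for all $u>0$, $f(u)>0$, $f'(u)>0$, $f''(u)>0$ and $F(u):=\int_u^\infty \frac{ds}{f(s)}<\infty$. $q_{JL}:=\frac{N-2\sqrt{N-1}}{4}$. For $\alpha>0$, $u(r,\alpha)$ denotes the unique solution of $u''+\frac{N-1}{r}u'+f(u)=0$ for $r>0$, $u(0)=\alpha$, $u'(0)=0$. A solution $u\in C^2(\mathbb{R}^N)$ of $\Delta u+f(u)=0$ in $\mathbb{R}^N$ is called stable if $\int_{\mathbb{R}^N}(|\nabla\phi|^2-f'(u)\phi^2)\,dx\ge 0$ for every $\phi\in C^1_0(\mathbb{R}^N)$ ($C^1$ functions with compact support), and unstable if it is not stable. We say $u(r,\alpha)$ is stable (unstable) if $x\mapsto u(|x|,\alpha)$ is. *)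

theory Defs
  imports "HOL-Analysis.Analysis"
begin

definition tail_integral :: "(real \<Rightarrow> real) \<Rightarrow> real \<Rightarrow> real" where
  "tail_integral f u = (LBINT s:{u..}. 1 / f s)"

text \<open>Since \<open>1 / f\<close> is positive on \<open>{u..}\<close> for \<open>u > 0\<close>, finiteness of its integral
  is the same as integrability.\<close>

definition admissible :: "(real \<Rightarrow> real) \<Rightarrow> bool" where
  "admissible f \<longleftrightarrow>
     (\<forall>u. f differentiable (at u)) \<and> continuous_on UNIV (deriv f) \<and>
     (\<forall>u. u \<noteq> 0 \<longrightarrow> deriv f differentiable (at u)) \<and>
     continuous_on (- {0}) (deriv (deriv f)) \<and>
     (\<forall>u. f (- u) = - f u) \<and>
     (\<forall>u>0. f u > 0 \<and> deriv f u > 0 \<and> deriv (deriv f) u > 0 \<and>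
        set_integrable lborel {u..} (\<lambda>s. 1 / f s))"

definition q_JL :: "nat \<Rightarrow> real" where
  "q_JL N = (real N - 2 * sqrt (real N - 1)) / 4"

text \<open>Only the values of \<open>u\<close> on \<open>{0..}\<close> matter; the derivative at \<open>0\<close> is one-sided.
  Continuity of the second derivative on \<open>r > 0\<close> follows from the equation.\<close>

definition radial_solution :: "nat \<Rightarrow> (real \<Rightarrow> real) \<Rightarrow> real \<Rightarrow> (real \<Rightarrow> real) \<Rightarrow> bool" where
  "radial_solution N f \<alpha> u \<longleftrightarrow>
     u 0 = \<alpha> \<and> (u has_real_derivative 0) (at 0 within {0..}) \<and>
     (\<forall>r>0. u differentiable (at r) \<and> deriv u differentiable (at r) \<and>
        deriv (deriv u) r + (real N - 1) / r * deriv u r + f (u r) = 0)"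

definition gradient :: "(real^'n \<Rightarrow> real) \<Rightarrow> real^'n \<Rightarrow> real^'n" where
  "gradient \<phi> x = (THE D. GDERIV \<phi> x :> D)"

definition laplacian :: "(real^'n \<Rightarrow> real) \<Rightarrow> real^'n \<Rightarrow> real" where
  "laplacian \<phi> x = trace (jacobian (gradient \<phi>) (at x))"

definition C1 :: "(real^'n \<Rightarrow> real) \<Rightarrow> bool" where
  "C1 \<phi> \<longleftrightarrow> (\<forall>x. \<phi> differentiable (at x)) \<and> continuous_on UNIV (gradient \<phi>)"

definition C2 :: "(real^'n \<Rightarrow> real) \<Rightarrow> bool" where
  "C2 \<phi> \<longleftrightarrow> C1 \<phi> \<and> (\<forall>x. gradient \<phi> differentiable (at x)) \<and>
     continuous_on UNIV (\<lambda>x. jacobian (gradient \<phi>) (at x))"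

definition entire_solution :: "(real \<Rightarrow> real) \<Rightarrow> (real^'n \<Rightarrow> real) \<Rightarrow> bool" where
  "entire_solution f u \<longleftrightarrow> C2 u \<and> (\<forall>x. laplacian u x + f (u x) = 0)"

text \<open>For admissible \<open>f\<close> and continuous \<open>u\<close> the integrand below is continuous with compact
  support, hence integrable.\<close>

definition stable :: "(real \<Rightarrow> real) \<Rightarrow> (real^'n \<Rightarrow> real) \<Rightarrow> bool" where
  "stable f u \<longleftrightarrow> entire_solution f u \<and>
     (\<forall>\<phi>. C1 \<phi> \<and> compact (closure {x. \<phi> x \<noteq> 0}) \<longrightarrow>
        0 \<le> (\<integral>x. (norm (gradient \<phi> x))\<^sup>2 - deriv f (u x) * (\<phi> x)\<^sup>2 \<partial>lborel))"

text \<open>Both stability and instability are properties of entire solutions only.\<close>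

definition unstable :: "(real \<Rightarrow> real) \<Rightarrow> (real^'n \<Rightarrow> real) \<Rightarrow> bool" where
  "unstable f u \<longleftrightarrow> entire_solution f u \<and> \<not> stable f u"

end

theory Submission
  imports Defs
begin

text \<open>Testing stability with \<open>u' \<eta>\<close> gives
  \<open>(N - 1) \<integral> r\<^bsup>N-3\<^esup> u'\<^sup>2 \<eta>\<^sup>2 \<le> \<integral> r\<^bsup>N-1\<^esup> u'\<^sup>2 \<eta>'\<^sup>2\<close>, which for \<open>\<eta>\<close> close to
  \<open>r\<^bsup>-sqrt (N-1)\<^esup>\<close> forbids a positive solution to decay faster than \<open>r\<^bsup>-2 (q_JL - 1)\<^esup>\<close>. On the other hand,
  the equation forces \<open>F(u(r)) \<ge> r\<^sup>2 / (2 N)\<close>, and \<open>f' F \<ge> q\<close> near \<open>0\<close> integrates to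
  \<open>u \<le> C F(u)\<^bsup>1-q\<^esup>\<close>, so that \<open>u \<le> C r\<^bsup>-2 (q - 1)\<^esup>\<close> for some \<open>q > q_JL\<close>. A solution with a zero is unstable
  since \<open>f(u) < f'(u) u\<close> on the ball where it is positive.\<close>

section \<open>Integration in polar coordinates\<close>

text \<open>Differentiating the radial equation shows that \<open>deriv u\<close> solves a linear
  equation with potential f'(u) - (N-1)/r^2. Against it the f'(u) of the stability form cancels,
  which is why an inequality between u' and \<eta> alone remains, whatever f is. The constant
  \<open>q_JL N\<close> is where this inequality is critical: with u' of order r^(1-2q) and \<eta> =
  r^(-a), the integrand r^(N-1) u'^2 \<eta>'^2 has order r^(N-1-4q-2a), which for a = sqrt (N-1) is
  r^(-1) exactly when q = \<open>q_JL N\<close>. The gap between q0 and \<open>q_JL N\<close> pays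
  for taking a slightly below sqrt (N-1), where the main term has a strict sign. From N \<ge> 11
  comes \<open>q_JL N\<close> > 1, so that the power bound on u is a decay. The point r = 0 is
  singular for the equation: test functions are therefore supported in annuli, and the C2 regularity
  of u(|x|) at the origin, part of the notion of instability, has to be extracted from
  limits.\<close>

lemma distr_norm_lborel:
  "distr lborel borel (norm :: 'a::euclidean_space \<Rightarrow> real) =
     density lborel (\<lambda>r. ennreal (if 0 \<le> r
       then unit_ball_vol (real DIM('a)) * real DIM('a) * r ^ (DIM('a) - 1) else 0))"
    (is "?M = density lborel (\<lambda>r. ennreal (?d r))")
\<comment> \<open>Half-lines generate the Borel sets and are closed under intersection, so it
  suffices to match the volume of a ball with the integral of the density, whose primitive is c
  r^n.\<close>
proof (rule measure_eqI_generator_eq)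
  let ?c = "unit_ball_vol (real DIM('a))"
  have M: "emeasure ?M {..x} = ennreal (if 0 \<le> x then ?c * x ^ DIM('a) else 0)" for x
  proof -
    have "emeasure ?M {..x} = emeasure lborel (norm -` {..x} :: 'a set)"
      by (subst emeasure_distr) auto
    also have "norm -` {..x} = (cball 0 x :: 'a set)"
      by auto
    also have "emeasure lborel \<dots> = ennreal (if 0 \<le> x then ?c * x ^ DIM('a) else 0)"
      by (auto simp: emeasure_cball)
    finally show ?thesis .
  qed
  show "Int_stable (range atMost :: real set set)"
    by (auto simp: Int_stable_def image_iff intro: exI[of _ "min _ _"])
  show "sets ?M = sigma_sets UNIV (range atMost)"
    by (simp add: borel_eq_atMost)
  show "sets (density lborel (\<lambda>r. ennreal (?d r))) = sigma_sets UNIV (range atMost)"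
    by (simp add: borel_eq_atMost)
  show "range (\<lambda>n::nat. {..real n}) \<subseteq> range atMost"
    by auto
  show "(\<Union>n. {..real n}) = UNIV"
    using real_arch_simple by auto
  show "emeasure ?M {..real n} \<noteq> \<infinity>" for n
    by (simp add: M)
  have d_meas [measurable]: "?d \<in> borel_measurable borel"
    by measurable
  fix X :: "real set" assume "X \<in> range atMost"
  then obtain x where X: "X = {..x}" by auto
  have "emeasure (density lborel (\<lambda>r. ennreal (?d r))) X
      = (\<integral>\<^sup>+r. ennreal (?d r) * indicator {..x} r \<partial>lborel)"
    unfolding X by (subst emeasure_density) auto
  also have "\<dots> = ennreal (if 0 \<le> x then ?c * x ^ DIM('a) else 0)"
  proof (cases "0 \<le> x")
    case True
    have "(\<integral>\<^sup>+r. ennreal (?d r) * indicator {..x} r \<partial>lborel)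
        = (\<integral>\<^sup>+r. ennreal (?d r) * indicator {0..x} r \<partial>lborel)"
      by (intro nn_integral_cong) (auto split: split_indicator)
    also have "\<dots> = ennreal (?c * x ^ DIM('a) - ?c * 0 ^ DIM('a))"
    proof (rule nn_integral_FTC_Icc[where f = ?d and F = "\<lambda>r. ?c * r ^ DIM('a)", OF d_meas _ _ True])
      fix r assume "r \<in> {0..x}"
      then show "((\<lambda>r. ?c * r ^ DIM('a)) has_real_derivative ?d r) (at r)"
        by (auto intro!: derivative_eq_intros)
      show "0 \<le> ?d r" by simp
    qed
    finally show ?thesis using True by simp
  next
    case False
    then have "(\<integral>\<^sup>+r. ennreal (?d r) * indicator {..x} r \<partial>lborel) = (\<integral>\<^sup>+(r::real). 0 \<partial>lborel)"
      by (intro nn_integral_cong) (auto split: split_indicator)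
    then show ?thesis using False by simp
  qed
  finally show "emeasure ?M X = emeasure (density lborel (\<lambda>r. ennreal (?d r))) X"
    by (simp add: M X)
qed auto

text \<open>Pushing Lebesgue measure forward along \<open>norm\<close> gives it the area of the
  sphere of radius r as density. The indicator keeps everything on a compact interval, where
  continuity of \<open>k\<close> yields measurability and integrability.\<close>

lemma integral_lborel_radial:
  fixes k :: "real \<Rightarrow> real"
  assumes "0 \<le> a" and "continuous_on {a..b} k"
  shows "(\<integral>(x::'a::euclidean_space). indicator {a..b} (norm x) * k (norm x) \<partial>lborel) =
     unit_ball_vol (real DIM('a)) * real DIM('a) * integral {a..b} (\<lambda>r. r ^ (DIM('a) - 1) * k r)"
proof -
  let ?c = "unit_ball_vol (real DIM('a)) * real DIM('a)"
  let ?d = "\<lambda>r. if 0 \<le> r then ?c * r ^ (DIM('a) - 1) else 0 :: real"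
  have m: "(\<lambda>r. indicator {a..b} r * k r) \<in> borel_measurable borel"
    using borel_measurable_continuous_on_indicator[OF _ assms(2)] by simp
  have [measurable]: "?d \<in> borel_measurable borel"
    by measurable
  have "(\<integral>(x::'a). indicator {a..b} (norm x) * k (norm x) \<partial>lborel)
      = integral\<^sup>L (distr lborel borel (norm :: 'a \<Rightarrow> real)) (\<lambda>r. indicator {a..b} r * k r)"
    by (rule integral_distr[symmetric]) (use m in auto)
  also have "\<dots> = (\<integral>r. ?d r *\<^sub>R (indicator {a..b} r * k r) \<partial>lborel)"
    unfolding distr_norm_lborel by (rule integral_density) (use m in auto)
  also have "\<dots> = (\<integral>r. ?c * (indicator {a..b} r *\<^sub>R (r ^ (DIM('a) - 1) * k r)) \<partial>lborel)"
    using assms(1) by (intro Bochner_Integration.integral_cong) (auto split: split_indicator)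
  also have "\<dots> = ?c * (LBINT r:{a..b}. r ^ (DIM('a) - 1) * k r)"
    unfolding set_lebesgue_integral_def by simp
  also have "(LBINT r:{a..b}. r ^ (DIM('a) - 1) * k r) = integral {a..b} (\<lambda>r. r ^ (DIM('a) - 1) * k r)"
    by (intro set_borel_integral_eq_integral borel_integrable_atLeastAtMost' continuous_intros assms)
  finally show ?thesis .
qed

section \<open>Cutoff functions\<close>

text \<open>Squaring removes the kink at 0, where the difference quotient is at most |h|. Translates
  of this C1 function are the pieces of the cutoffs.\<close>

lemma DERIV_max_0_square: "((\<lambda>t::real. (max 0 t)\<^sup>2) has_real_derivative 2 * max 0 t) (at t)"
proof -
  consider "t < 0" | "t = 0" | "0 < t" by linarith
  then show ?thesis
  proof cases
    case 1
    have "((\<lambda>t::real. 0) has_real_derivative 2 * max 0 t) (at t)"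
      using 1 by (auto intro!: derivative_eq_intros)
    then show ?thesis
      by (rule has_field_derivative_transform_within_open[where S = "{..<0}"]) (use 1 in auto)
  next
    case 2
    have "((\<lambda>h::real. (max 0 h)\<^sup>2 / h) \<longlongrightarrow> 0) (at 0)"
    proof (rule Lim_null_comparison)
      show "\<forall>\<^sub>F h in at 0. norm ((max 0 h)\<^sup>2 / h) \<le> \<bar>h\<bar>"
        by (auto simp: eventually_at_filter power2_eq_square max_def)
      show "((\<lambda>h::real. \<bar>h\<bar>) \<longlongrightarrow> 0) (at 0)"
        by (auto intro!: tendsto_eq_intros)
    qed
    then show ?thesis using 2 by (simp add: DERIV_def)
  next
    case 3
    have "((\<lambda>t::real. t\<^sup>2) has_real_derivative 2 * max 0 t) (at t)"
      using 3 by (auto intro!: derivative_eq_intros)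
    then show ?thesis
      by (rule has_field_derivative_transform_within_open[where S = "{0<..}"]) (use 3 in auto)
  qed
qed

text \<open>Quadratic spline with knots 0, 1/2 and 1: it is 2 t^2 on the first half of the unit
  interval and 1 - 2 (1-t)^2 on the second. Its derivative is a tent of height 2.\<close>

definition smooth_step :: "real \<Rightarrow> real" where
  "smooth_step t = 2 * (max 0 t)\<^sup>2 - 4 * (max 0 (t - 1/2))\<^sup>2 + 2 * (max 0 (t - 1))\<^sup>2"

definition smooth_step' :: "real \<Rightarrow> real" where
  "smooth_step' t = 4 * max 0 t - 8 * max 0 (t - 1/2) + 4 * max 0 (t - 1)"

lemma DERIV_smooth_step [derivative_intros]:
  assumes "(g has_real_derivative g') (at t)"
  shows "((\<lambda>t. smooth_step (g t)) has_real_derivative smooth_step' (g t) * g') (at t)"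
  unfolding smooth_step_def smooth_step'_def
proof -
  have "((\<lambda>t. (max 0 (g t - c))\<^sup>2) has_real_derivative 2 * max 0 (g t - c) * g') (at t)" for c
    by (rule DERIV_chain2[OF DERIV_max_0_square]) (use assms in \<open>auto intro!: derivative_eq_intros\<close>)
  note d = this[THEN DERIV_cmult]
  from DERIV_add[OF DERIV_diff[OF d[of 2 0] d[of 4 "1/2"]] d[of 2 1]]
  show "((\<lambda>t. 2 * (max 0 (g t))\<^sup>2 - 4 * (max 0 (g t - 1/2))\<^sup>2 + 2 * (max 0 (g t - 1))\<^sup>2)
    has_real_derivative (4 * max 0 (g t) - 8 * max 0 (g t - 1/2) + 4 * max 0 (g t - 1)) * g') (at t)"
    by (simp add: algebra_simps)
qed

lemma continuous_on_smooth_step' [continuous_intros]: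
  "continuous_on S g \<Longrightarrow> continuous_on S (\<lambda>t. smooth_step' (g t))"
  unfolding smooth_step'_def by (intro continuous_intros)

lemma smooth_step_eq_0: "t \<le> 0 \<Longrightarrow> smooth_step t = 0" "t \<le> 0 \<Longrightarrow> smooth_step' t = 0"
  by (auto simp: smooth_step_def smooth_step'_def)

lemma smooth_step_eq_1: "1 \<le> t \<Longrightarrow> smooth_step t = 1" "1 \<le> t \<Longrightarrow> smooth_step' t = 0"
  by (simp_all add: smooth_step_def smooth_step'_def max_absorb2)
     (simp add: power2_eq_square algebra_simps)

lemma smooth_step'_bounds: "0 \<le> smooth_step' t" "smooth_step' t \<le> 2"
  by (auto simp: smooth_step'_def max_def)

lemma smooth_step_bounds: "0 \<le> smooth_step t" "smooth_step t \<le> 1"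
proof -
  have mono: "smooth_step x \<le> smooth_step y" if "x \<le> y" for x y
    using that smooth_step'_bounds(1)
    by (intro DERIV_nonneg_imp_nondecreasing[OF that])
       (metis DERIV_smooth_step[OF DERIV_ident] mult.right_neutral)
  show "0 \<le> smooth_step t"
    using mono[of "min 0 t" t] smooth_step_eq_0[of "min 0 t"] by simp
  show "smooth_step t \<le> 1"
    using mono[of t "max 1 t"] smooth_step_eq_1[of "max 1 t"] by simp
qed

text \<open>Take the product of a rising and a falling step. Since b \<le> c, one factor is
  constantly 1 wherever the other one varies, so each layer sees a single derivative; the 2 in the
  bounds is the height of the tent.\<close>

lemma cutoff_exists:
  fixes a b c d :: real
  assumes "a < b" "b \<le> c" "c < d"
  obtains \<theta> \<theta>' where "\<And>r. (\<theta> has_real_derivative \<theta>' r) (at r)" "continuous_on UNIV \<theta>'"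
    "\<And>r. r \<notin> {a<..<d} \<Longrightarrow> \<theta> r = 0" "\<And>r. r \<notin> {a<..<d} \<Longrightarrow> \<theta>' r = 0"
    "\<And>r. \<bar>\<theta> r\<bar> \<le> 1" "\<And>r. r \<in> {b..c} \<Longrightarrow> \<theta> r = 1" "\<And>r. r \<in> {b..c} \<Longrightarrow> \<theta>' r = 0"
    "\<And>r. r \<in> {a..b} \<Longrightarrow> \<bar>\<theta>' r\<bar> \<le> 2 / (b - a)" "\<And>r. r \<in> {c..d} \<Longrightarrow> \<bar>\<theta>' r\<bar> \<le> 2 / (d - c)"
proof
  let ?p = "\<lambda>r. (r - a) / (b - a)" and ?q = "\<lambda>r. (d - r) / (d - c)"
  let ?f = "\<lambda>r. smooth_step (?p r) * smooth_step (?q r)"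
  let ?f' = "\<lambda>r. smooth_step' (?p r) / (b - a) * smooth_step (?q r)
                - smooth_step (?p r) * (smooth_step' (?q r) / (d - c))"
  have p0: "?p r \<le> 0" if "r \<le> a" for r
    using that assms by (auto simp: divide_simps)
  have q0: "?q r \<le> 0" if "d \<le> r" for r
    using that assms by (auto simp: divide_simps)
  have p1: "1 \<le> ?p r" if "b \<le> r" for r
    using that assms by (auto simp: divide_simps)
  have q1: "1 \<le> ?q r" if "r \<le> c" for r
    using that assms by (auto simp: divide_simps)
  show "(?f has_real_derivative ?f' r) (at r)" for r
  proof -
    have "(?p has_real_derivative 1 / (b - a)) (at r)" "(?q has_real_derivative - 1 / (d - c)) (at r)"
      using assms by (auto intro!: derivative_eq_intros simp: divide_simps)
    from DERIV_mult[OF this[THEN DERIV_smooth_step]] show ?thesis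
      by (simp add: algebra_simps)
  qed
  have "continuous_on UNIV smooth_step"
    using DERIV_smooth_step[OF DERIV_ident]
    by (metis DERIV_isCont continuous_at_imp_continuous_on)
  then have [continuous_intros]: "continuous_on S (\<lambda>r. smooth_step (g r))"
    if "continuous_on S g" for g :: "real \<Rightarrow> real" and S
    using continuous_on_compose2[OF _ that] by blast
  show "continuous_on UNIV ?f'"
    using assms by (intro continuous_intros) auto
  show "?f r = 0" "?f' r = 0" if "r \<notin> {a<..<d}" for r
    using that p0[of r] q0[of r] smooth_step_eq_0[of "?p r"] smooth_step_eq_0[of "?q r"]
    by (auto simp: not_less)
  show "\<bar>?f r\<bar> \<le> 1" for r
    using smooth_step_bounds[of "?p r"] smooth_step_bounds[of "?q r"]
    by (simp add: abs_mult mult_le_one)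
  show "?f r = 1" "?f' r = 0" if "r \<in> {b..c}" for r
    using that p1[of r] q1[of r] smooth_step_eq_1[of "?p r"] smooth_step_eq_1[of "?q r"]
    by auto
  show "\<bar>?f' r\<bar> \<le> 2 / (b - a)" if "r \<in> {a..b}" for r
    using that assms q1[of r] smooth_step_eq_1[of "?q r"] smooth_step'_bounds[of "?p r"]
    by (auto intro!: divide_right_mono)
  show "\<bar>?f' r\<bar> \<le> 2 / (d - c)" if "r \<in> {c..d}" for r
    using that assms p1[of r] smooth_step_eq_1[of "?p r"] smooth_step'_bounds[of "?q r"]
    by (auto intro!: divide_right_mono)
qed

section \<open>Upper bounds for integrals with transition layers\<close>

lemma integral_le_const:
  fixes k :: "real \<Rightarrow> real"
  assumes "a \<le> b" "k integrable_on {a..b}" "\<And>r. r \<in> {a..b} \<Longrightarrow> k r \<le> C"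
  shows "integral {a..b} k \<le> C * (b - a)"
proof -
  have "integral {a..b} k \<le> integral {a..b} (\<lambda>_. C)"
    by (rule integral_le) (use assms in auto)
  then show ?thesis using assms(1) by (simp add: mult.commute)
qed

text \<open>The shape of both final contradictions: \<open>A\<close> and \<open>B\<close> bound the
  integrand on the two layers of a cutoff, it is nonpositive on the plateau, and a fixed interval
  inside the plateau contributes the gain \<open>m\<close>.\<close>

lemma integral_le_piecewise:
  fixes k :: "real \<Rightarrow> real"
  assumes "a \<le> b" "b \<le> p" "p \<le> q" "q \<le> c" "c \<le> d"
    and k: "continuous_on {a..d} k"
    and "\<And>r. r \<in> {a..b} \<Longrightarrow> k r \<le> A" "\<And>r. r \<in> {b..c} \<Longrightarrow> k r \<le> 0"
    and "\<And>r. r \<in> {p..q} \<Longrightarrow> k r \<le> - m" "\<And>r. r \<in> {c..d} \<Longrightarrow> k r \<le> B"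
  shows "integral {a..d} k \<le> A * (b - a) - m * (q - p) + B * (d - c)"
proof -
  have i: "k integrable_on {x..y}" if "a \<le> x" "y \<le> d" for x y
    using that by (intro integrable_continuous_real continuous_on_subset[OF k]) auto
  have "integral {a..d} k = integral {a..b} k + (integral {b..p} k + (integral {p..q} k
        + (integral {q..c} k + integral {c..d} k)))"
    using assms(1-5) i
    by (simp add: Henstock_Kurzweil_Integration.integral_combine)
  also have "\<dots> \<le> A * (b - a) + (0 * (p - b) + ((- m) * (q - p) + (0 * (c - q) + B * (d - c))))"
    by (intro add_mono integral_le_const i) (use assms in auto)
  finally show ?thesis by simp
qed

section \<open>Admissible nonlinearities\<close>

lemma tail_integral_split:
  assumes "set_integrable lborel {u..} (\<lambda>s. 1 / f s)" "u \<le> v"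
  shows "tail_integral f u = (LBINT s:{u..v}. 1 / f s) + tail_integral f v"
proof -
  have s: "{u..} = {u..v} \<union> {v<..}" using assms(2) by auto
  have i: "set_integrable lborel {u..v} (\<lambda>s. 1 / f s)" "set_integrable lborel {v<..} (\<lambda>s. 1 / f s)"
    by (rule set_integrable_subset[OF assms(1)]; use assms(2) in auto)+
  have "tail_integral f u = (LBINT s:{u..v}. 1 / f s) + (LBINT s:{v<..}. 1 / f s)"
    unfolding tail_integral_def s by (rule set_integral_Un) (use i in auto)
  also have "(LBINT s:{v<..}. 1 / f s) = (LBINT s:{v..}. 1 / f s)"
    unfolding set_lebesgue_integral_def
    by (rule integral_cong_AE)
       (use i set_integrable_subset[OF assms(1), of "{v..}"] assms(2) AE_lborel_singleton[of v] in
         \<open>auto simp: set_integrable_def dest: borel_measurable_integrable split: split_indicator elim!: eventually_mono\<close>)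
  finally show ?thesis unfolding tail_integral_def .
qed

locale admissible_nonlinearity =
  fixes f :: "real \<Rightarrow> real"
  assumes admissible: "admissible f"
begin

lemma DERIV_f: "(f has_real_derivative deriv f s) (at s)"
  using admissible by (simp add: admissible_def DERIV_deriv_iff_real_differentiable)

lemma continuous_on_f [continuous_intros]:
  "continuous_on S g \<Longrightarrow> continuous_on S (\<lambda>x. f (g x))"
  by (rule continuous_on_compose2[OF DERIV_continuous_on[OF DERIV_f]]) simp_all

lemma continuous_on_deriv_f [continuous_intros]:
  "continuous_on S g \<Longrightarrow> continuous_on S (\<lambda>x. deriv f (g x))"
proof -
  have "continuous_on UNIV (deriv f)"
    using admissible unfolding admissible_def by blast
  then show "continuous_on S g \<Longrightarrow> continuous_on S (\<lambda>x. deriv f (g x))"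
    by (rule continuous_on_compose2) simp_all
qed

lemma f_0: "f 0 = 0"
proof -
  have "f (- 0) = - f 0" using admissible unfolding admissible_def by blast
  then show ?thesis by simp
qed

lemma f_pos: "0 < s \<Longrightarrow> 0 < f s" and deriv_f_pos: "0 < s \<Longrightarrow> 0 < deriv f s"
  and integrable_tail: "0 < s \<Longrightarrow> set_integrable lborel {s..} (\<lambda>s. 1 / f s)"
  using admissible unfolding admissible_def by blast+

lemma deriv_f_strict_mono:
  assumes "0 < s" "s < t" shows "deriv f s < deriv f t"
proof (rule DERIV_pos_imp_increasing[OF assms(2)])
  fix x assume "s \<le> x" "x \<le> t"
  then have "deriv f differentiable (at x)" "0 < deriv (deriv f) x"
    using admissible assms by (simp_all add: admissible_def)
  then show "\<exists>y. (deriv f has_real_derivative y) (at x) \<and> 0 < y"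
    using DERIV_deriv_iff_real_differentiable by blast
qed

text \<open>Since f vanishes at 0, f(s)/s is the value of f' at an intermediate point, and f' is
  strictly increasing by convexity.\<close>

lemma f_less_deriv_f: assumes "0 < s" shows "f s < s * deriv f s"
proof -
  obtain z where z: "0 < z" "z < s" "f s - f 0 = (s - 0) * deriv f z"
    using MVT2[OF assms DERIV_f] by blast
  then show ?thesis using deriv_f_strict_mono[of z s] assms f_0 by simp
qed

lemma DERIV_tail_integral:
  assumes "0 < s" shows "(tail_integral f has_real_derivative - (1 / f s)) (at s)"
proof -
  \<comment> \<open>With a positive base point a below s, F is near s a constant minus a proper
    integral of a continuous function, to which the fundamental theorem applies.\<close>
  define a b where "a = s / 2" and "b = s + 1"
  have ab: "0 < a" "a < s" "s < b" using assms by (auto simp: a_def b_def)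
  have c: "continuous_on {a..b} (\<lambda>s. 1 / f s)"
  proof (intro continuous_intros ballI)
    fix x assume "x \<in> {a..b}"
    then show "f x \<noteq> 0" using f_pos[of x] ab by simp
  qed
  have eq: "tail_integral f x = tail_integral f a - integral {a..x} (\<lambda>s. 1 / f s)"
    if "x \<in> {a<..<b}" for x
  proof -
    have "set_integrable lborel {a..x} (\<lambda>s. 1 / f s)"
      by (rule set_integrable_subset[OF integrable_tail[OF ab(1)]]) auto
    then show ?thesis
      using tail_integral_split[OF integrable_tail[OF ab(1)], of x] that
        set_borel_integral_eq_integral(2)[of "{a..x}" "\<lambda>s. 1 / f s"]
      by simp
  qed
  have "((\<lambda>x. integral {a..x} (\<lambda>s. 1 / f s)) has_real_derivative 1 / f s) (at s within {a..b})"
    by (rule integral_has_real_derivative[OF c]) (use ab in auto)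
  then have "((\<lambda>x. integral {a..x} (\<lambda>s. 1 / f s)) has_real_derivative 1 / f s) (at s)"
    using ab by (simp add: at_within_Icc_at)
  then have "((\<lambda>x. tail_integral f a - integral {a..x} (\<lambda>s. 1 / f s)) has_real_derivative 0 - 1 / f s) (at s)"
    by (intro DERIV_diff DERIV_const)
  then have "(tail_integral f has_real_derivative 0 - 1 / f s) (at s)"
    by (rule has_field_derivative_transform_within_open[where S = "{a<..<b}"])
       (use ab in \<open>simp_all add: eq[symmetric]\<close>)
  then show ?thesis by simp
qed

lemma tail_integral_strict_antimono: "0 < s \<Longrightarrow> s < t \<Longrightarrow> tail_integral f t < tail_integral f s"
  by (rule DERIV_neg_imp_decreasing[of s t], assumption, rule exI, rule conjI, rule DERIV_tail_integral)
     (simp_all add: f_pos)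

lemma tail_integral_pos: assumes "0 < s" shows "0 < tail_integral f s"
proof -
  have "0 \<le> tail_integral f (s + 1)"
    unfolding tail_integral_def set_lebesgue_integral_def
    using assms by (intro Bochner_Integration.integral_nonneg)
      (auto split: split_indicator intro!: less_imp_le f_pos)
  then show ?thesis using tail_integral_strict_antimono[of s "s + 1"] assms by simp
qed

end

section \<open>Radial test functions\<close>

lemma gradient_eq:
  assumes "GDERIV \<phi> x :> D" shows "gradient \<phi> x = D"
  unfolding gradient_def
proof (rule the_equality, rule assms)
  fix D' assume "GDERIV \<phi> x :> D'"
  with assms have "(\<lambda>h. inner h D') = (\<lambda>h. inner h D)"
    unfolding gderiv_def by (intro has_derivative_unique)
  then show "D' = D"
    by (metis vector_eq_ldot)
qed

text \<open>Polar coordinates reduce the stability form to one variable, up to a positive factor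
  that is divided out at the end. Support in r \<ge> a > 0 keeps the test function C1 at the origin,
  where the norm is not differentiable.\<close>

lemma stable_radial_test:
  fixes u g g' :: "real \<Rightarrow> real"
  assumes stable: "stable f (\<lambda>x::real^'n. u (norm x))"
    and "0 < a"
    and g: "\<And>r. (g has_real_derivative g' r) (at r)"
    and g': "continuous_on UNIV g'"
    and g0: "\<And>r. r \<notin> {a..b} \<Longrightarrow> g r = 0" "\<And>r. r \<notin> {a..b} \<Longrightarrow> g' r = 0"
    and fu: "continuous_on {a..b} (\<lambda>r. deriv f (u r))"
  shows "0 \<le> integral {a..b} (\<lambda>r. r ^ (CARD('n) - 1) * ((g' r)\<^sup>2 - deriv f (u r) * (g r)\<^sup>2))"
    (is "0 \<le> integral _ (\<lambda>r. _ * ?k r)")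
proof -
  define \<phi> where "\<phi> = (\<lambda>x::real^'n. g (norm x))"
  have near0: "g (norm x) = 0" "g' (norm x) = 0" if "x \<in> ball 0 a" for x :: "real^'n"
    using that g0 by auto
  have GD: "GDERIV \<phi> x :> g' (norm x) *\<^sub>R sgn x" for x
  proof (cases "x = 0")
    case True
    have "((\<lambda>x::real^'n. 0) has_derivative (\<lambda>h. 0)) (at x)"
      by simp
    then have "(\<phi> has_derivative (\<lambda>h. 0)) (at x)"
      by (rule has_derivative_transform_within_open[where s = "ball 0 a"])
         (use True \<open>0 < a\<close> near0 in \<open>auto simp: \<phi>_def\<close>)
    then show ?thesis using True by (simp add: gderiv_def)
  next
    case False
    then show ?thesis
      unfolding \<phi>_def by (intro GDERIV_DERIV_compose[OF GDERIV_norm g])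
  qed
  have grad: "gradient \<phi> = (\<lambda>x. g' (norm x) *\<^sub>R sgn x)"
    using gradient_eq[OF GD] by blast
  have "continuous_on (ball 0 a \<union> (- {0})) (\<lambda>x::real^'n. g' (norm x) *\<^sub>R sgn x)"
  proof (rule continuous_on_open_Un)
    show "continuous_on (ball 0 a) (\<lambda>x::real^'n. g' (norm x) *\<^sub>R sgn x)"
      using near0 continuous_on_cong[of "ball 0 a" "ball 0 a" "\<lambda>x::real^'n. g' (norm x) *\<^sub>R sgn x" "\<lambda>_. 0"]
      by simp
    show "continuous_on (- {0}) (\<lambda>x::real^'n. g' (norm x) *\<^sub>R sgn x)"
      unfolding sgn_div_norm
      by (intro continuous_intros continuous_on_compose2[OF g']) auto
  qed auto
  moreover have "ball 0 a \<union> (- {0}) = (UNIV :: (real^'n) set)"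
    using \<open>0 < a\<close> by auto
  ultimately have "C1 \<phi>"
    unfolding C1_def grad using GD by (auto simp: gderiv_def differentiable_def)
  moreover have "compact (closure {x. \<phi> x \<noteq> 0})"
  proof -
    have "{x. \<phi> x \<noteq> 0} \<subseteq> cball 0 b"
      using g0 by (force simp: \<phi>_def)
    then show ?thesis
      using bounded_cball bounded_subset compact_closure by blast
  qed
  ultimately have "0 \<le> (\<integral>x. (norm (gradient \<phi> x))\<^sup>2 - deriv f (u (norm x)) * (\<phi> x)\<^sup>2 \<partial>lborel)"
    using stable unfolding stable_def by blast
  also have "(\<lambda>x. (norm (gradient \<phi> x))\<^sup>2 - deriv f (u (norm x)) * (\<phi> x)\<^sup>2)
      = (\<lambda>x. indicator {a..b} (norm x) * ?k (norm x))"
  proof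
    fix x :: "real^'n"
    show "(norm (gradient \<phi> x))\<^sup>2 - deriv f (u (norm x)) * (\<phi> x)\<^sup>2
        = indicator {a..b} (norm x) * ?k (norm x)"
      using g0[of "norm x"] \<open>0 < a\<close> unfolding grad
      by (cases "norm x \<in> {a..b}") (auto simp: \<phi>_def norm_sgn)
  qed
  also have "(\<integral>x. indicator {a..b} (norm x) * ?k (norm x) \<partial>(lborel :: (real^'n) measure))
     = unit_ball_vol (real DIM(real^'n)) * real DIM(real^'n) *
       integral {a..b} (\<lambda>r. r ^ (DIM(real^'n) - 1) * ?k r)"
  proof (rule integral_lborel_radial)
    have "continuous_on {a..b} g"
      by (meson DERIV_isCont continuous_at_imp_continuous_on g)
    then show "continuous_on {a..b} ?k"
      by (intro continuous_intros fu continuous_on_subset[OF g']) auto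
  qed (use \<open>0 < a\<close> in simp)
  finally have "unit_ball_vol (real CARD('n)) * real CARD('n) * 0 \<le> unit_ball_vol (real CARD('n)) * real CARD('n) *
      integral {a..b} (\<lambda>r. r ^ (CARD('n) - 1) * ?k r)"
    by simp
  moreover have "0 < unit_ball_vol (real CARD('n)) * real CARD('n)"
    by (simp add: unit_ball_vol_pos)
  ultimately show ?thesis
    by (rule mult_left_le_imp_le)
qed

section \<open>The stability form on multiples of solutions of linear equations\<close>

lemma DERIV_power_pred:
  fixes r :: real
  assumes "1 \<le> n" "0 < r"
  shows "((\<lambda>r. r ^ (n - 1)) has_real_derivative r ^ (n - 1) * ((real n - 1) / r)) (at r)"
proof -
  have "real (n - 1) * r ^ (n - 1 - Suc 0) = r ^ (n - 1) * ((real n - 1) / r)"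
    using assms by (cases "n - 1") (auto simp: of_nat_diff)
  then show ?thesis
    using DERIV_pow[of "n - 1" r] by simp
qed

text \<open>Once w'' is eliminated by the equation, the integrand is the derivative of r^(n-1) w w'
  \<eta>^2, which vanishes at both ends with \<eta>; the terms with \<open>V\<close> cancel.
  Integrability of the two parts separately is left to the caller.\<close>

lemma has_integral_radial_by_parts:
  fixes w w' w'' \<eta> \<eta>' P V :: "real \<Rightarrow> real"
  assumes "0 < a" "a \<le> b" "1 \<le> n"
    and w: "\<And>r. r \<in> {a..b} \<Longrightarrow> (w has_real_derivative w' r) (at r)"
    and w': "\<And>r. r \<in> {a..b} \<Longrightarrow> (w' has_real_derivative w'' r) (at r)"
    and \<eta>: "\<And>r. r \<in> {a..b} \<Longrightarrow> (\<eta> has_real_derivative \<eta>' r) (at r)"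
    and ode: "\<And>r. r \<in> {a..b} \<Longrightarrow> w'' r + (real n - 1) / r * w' r + P r * w r = 0"
    and "\<eta> a = 0" "\<eta> b = 0"
  shows "((\<lambda>r. r ^ (n - 1) * ((w' r * \<eta> r + w r * \<eta>' r)\<^sup>2 - V r * (w r * \<eta> r)\<^sup>2)
      - r ^ (n - 1) * ((w r * \<eta>' r)\<^sup>2 + (P r - V r) * (w r * \<eta> r)\<^sup>2)) has_integral 0) {a..b}"
    (is "(?k has_integral 0) _")
proof -
  define B where "B r = r ^ (n - 1) * (w' r * (w r * (\<eta> r)\<^sup>2))" for r
  have "(?k has_integral (B b - B a)) {a..b}"
  proof (rule fundamental_theorem_of_calculus[OF assms(2)])
    fix r assume r: "r \<in> {a..b}"
    then have "r > 0" using \<open>0 < a\<close> by simp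
    note pow = DERIV_power_pred[OF \<open>1 \<le> n\<close> \<open>r > 0\<close>]
    have w''r: "w'' r = - ((real n - 1) / r * w' r) - P r * w r"
      using ode[OF r] by simp
    have "(B has_real_derivative ?k r) (at r)"
      unfolding B_def
      by (rule derivative_eq_intros pow w[OF r] w'[OF r] \<eta>[OF r] refl)+
         (simp add: w''r power2_eq_square algebra_simps)
    then show "(B has_vector_derivative ?k r) (at r within {a..b})"
      unfolding has_real_derivative_iff_has_vector_derivative[symmetric]
      by (rule has_field_derivative_at_within)
  qed
  then show ?thesis using assms by (simp add: B_def)
qed

text \<open>Factoring out a solution w of a linear equation with potential P trades the derivative
  of w for the difference P - f'(u). It serves twice: with w = u, P = f(u)/u, and with w = u', P =
  f'(u) - (N-1)/r^2.\<close>

lemma stable_radial_product_test: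
  fixes u w w' w'' \<eta> \<eta>' P :: "real \<Rightarrow> real"
  assumes stable: "stable f (\<lambda>x::real^'n. u (norm x))"
    and ab: "0 < a" "a \<le> b"
    and fu: "continuous_on {a..b} (\<lambda>r. deriv f (u r))"
    and w: "\<And>r. 0 < r \<Longrightarrow> (w has_real_derivative w' r) (at r)"
    and w': "\<And>r. 0 < r \<Longrightarrow> (w' has_real_derivative w'' r) (at r)"
    and \<eta>: "\<And>r. 0 < r \<Longrightarrow> (\<eta> has_real_derivative \<eta>' r) (at r)"
    and \<eta>': "continuous_on {0<..} \<eta>'"
    and \<eta>0: "\<And>r. r \<notin> {a<..<b} \<Longrightarrow> \<eta> r = 0" "\<And>r. r \<notin> {a<..<b} \<Longrightarrow> \<eta>' r = 0"
    and ode: "\<And>r. r \<in> {a..b} \<Longrightarrow> w'' r + (real CARD('n) - 1) / r * w' r + P r * w r = 0"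
  shows "0 \<le> integral {a..b} (\<lambda>r. r ^ (CARD('n) - 1)
             * ((w r * \<eta>' r)\<^sup>2 + (P r - deriv f (u r)) * (w r * \<eta> r)\<^sup>2))"
proof -
  \<comment> \<open>The factors are controlled for r > 0 only, whereas the test profile lives on the
    whole line. Extension by 0 is C1 because \<eta> vanishes below a.\<close>
  define g where "g r = (if 0 < r then w r * \<eta> r else 0)" for r
  define g' where "g' r = (if 0 < r then w' r * \<eta> r + w r * \<eta>' r else 0)" for r
  have gpos: "(g has_real_derivative g' r) (at r)" if "0 < r" for r
  proof -
    have "((\<lambda>r. w r * \<eta> r) has_real_derivative g' r) (at r)"
      using DERIV_mult[OF w[OF that] \<eta>[OF that]] that by (simp add: g'_def mult.commute)
    then show ?thesis
      by (rule has_field_derivative_transform_within_open[where S = "{0<..}"])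
         (use that in \<open>auto simp: g_def\<close>)
  qed
  have g: "(g has_real_derivative g' r) (at r)" for r
  proof (cases "0 < r")
    case False
    have "((\<lambda>r. 0) has_real_derivative g' r) (at r)"
      using False by (simp add: g'_def)
    then show ?thesis
      by (rule has_field_derivative_transform_within_open[where S = "{..<a}"])
         (use False ab \<eta>0 in \<open>auto simp: g_def\<close>)
  qed (rule gpos)
  have cont: "continuous_on {0<..} w" "continuous_on {0<..} w'" "continuous_on {0<..} \<eta>"
    by (rule DERIV_continuous_on, rule has_field_derivative_at_within, rule w w' \<eta>, simp)+
  have "continuous_on ({..<a} \<union> {0<..}) g'"
  proof (rule continuous_on_open_Un)
    have "g' r = 0" if "r < a" for r
      using that \<eta>0 by (simp add: g'_def)
    then show "continuous_on {..<a} g'"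
      using continuous_on_cong[of "{..<a}" "{..<a}" g' "\<lambda>_. 0"] by simp
    have "continuous_on {0<..} (\<lambda>r. w' r * \<eta> r + w r * \<eta>' r)"
      by (intro continuous_intros cont \<eta>')
    then show "continuous_on {0<..} g'"
      using continuous_on_cong[of "{0<..}" "{0<..}" g' "\<lambda>r. w' r * \<eta> r + w r * \<eta>' r"]
      by (simp add: g'_def)
  qed auto
  moreover have "{..<a} \<union> {0<..} = UNIV"
    using ab by auto
  ultimately have g': "continuous_on UNIV g'" by simp
  have "0 \<le> integral {a..b} (\<lambda>r. r ^ (CARD('n) - 1) * ((g' r)\<^sup>2 - deriv f (u r) * (g r)\<^sup>2))"
    by (rule stable_radial_test[OF stable ab(1) g g' _ _ fu]) (auto simp: g_def g'_def \<eta>0)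
  also have "\<dots> = integral {a..b} (\<lambda>r. r ^ (CARD('n) - 1) *
      ((w' r * \<eta> r + w r * \<eta>' r)\<^sup>2 - deriv f (u r) * (w r * \<eta> r)\<^sup>2))" (is "_ = integral _ ?h")
    using ab by (intro integral_cong) (auto simp: g_def g'_def)
  also have "\<dots> = integral {a..b} (\<lambda>r. r ^ (CARD('n) - 1)
             * ((w r * \<eta>' r)\<^sup>2 + (P r - deriv f (u r)) * (w r * \<eta> r)\<^sup>2))" (is "_ = integral _ ?k")
  proof -
    have D: "((\<lambda>r. ?h r - ?k r) has_integral 0) {a..b}"
      by (rule has_integral_radial_by_parts[OF ab _ _ _ _ ode])
         (use ab w w' \<eta> \<eta>0 in \<open>auto simp: Suc_le_eq\<close>)
    have "continuous_on {a..b} ?h"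
      by (intro continuous_intros fu continuous_on_subset[OF cont(1)] continuous_on_subset[OF cont(2)]
            continuous_on_subset[OF cont(3)] continuous_on_subset[OF \<eta>']) (use ab in auto)
    then have "?h integrable_on {a..b}"
      by (rule integrable_continuous_real)
    then have "(?h has_integral integral {a..b} ?h) {a..b}"
      by (rule integrable_integral)
    from has_integral_diff[OF this D] show ?thesis
      by (simp add: integral_unique)
  qed
  finally show ?thesis .
qed

section \<open>Radial solutions are entire solutions\<close>

lemma filterlim_norm_at_right_0:
  "filterlim (norm :: 'a::real_normed_vector \<Rightarrow> real) (at_right 0) (at 0)"
  unfolding filterlim_at
  by (auto intro!: tendsto_norm_zero tendsto_ident_at simp: eventually_at_filter)

locale radial_ode = admissible_nonlinearity f for f :: "real \<Rightarrow> real" +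
  fixes N :: nat and \<alpha> :: real and u :: "real \<Rightarrow> real"
  assumes N: "3 \<le> N" and \<alpha>: "0 < \<alpha>" and sol: "radial_solution N f \<alpha> u"
begin

lemma u_0: "u 0 = \<alpha>"
  using sol by (simp add: radial_solution_def)

lemma DERIV_u: "0 < r \<Longrightarrow> (u has_real_derivative deriv u r) (at r)"
  and DERIV_u': "0 < r \<Longrightarrow> (deriv u has_real_derivative deriv (deriv u) r) (at r)"
  using sol by (simp_all add: radial_solution_def DERIV_deriv_iff_real_differentiable)

lemma u''_eq: assumes "0 < r"
  shows "deriv (deriv u) r = - ((real N - 1) / r * deriv u r) - f (u r)"
proof -
  have "deriv (deriv u) r + (real N - 1) / r * deriv u r + f (u r) = 0"
    using sol assms unfolding radial_solution_def by blast
  then show ?thesis by simp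
qed

lemma DERIV_f_u: "0 < r \<Longrightarrow> ((\<lambda>r. f (u r)) has_real_derivative deriv f (u r) * deriv u r) (at r)"
  by (rule DERIV_chain2[OF DERIV_f DERIV_u])

text \<open>The equation expresses u'' through differentiable functions, so it can be differentiated
  once more. The result is the linearized equation for u', with the extra potential -(N-1)/r^2 that
  comes from the derivative of (N-1)/r.\<close>

lemma DERIV_u'': assumes "0 < r"
  shows "(deriv (deriv u) has_real_derivative
     - ((real N - 1) / r * deriv (deriv u) r) - (deriv f (u r) - (real N - 1) / r\<^sup>2) * deriv u r) (at r)"
proof -
  have q: "((\<lambda>r. (real N - 1) / r) has_real_derivative - ((real N - 1) / r\<^sup>2)) (at r)"
    using assms by (auto intro!: derivative_eq_intros simp: power2_eq_square divide_simps)
  have "((\<lambda>r. - ((real N - 1) / r * deriv u r) - f (u r)) has_real_derivative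
     - (- ((real N - 1) / r\<^sup>2) * deriv u r + deriv (deriv u) r * ((real N - 1) / r))
        - deriv f (u r) * deriv u r) (at r)"
    by (intro DERIV_diff DERIV_minus DERIV_mult q DERIV_u' DERIV_f_u assms)
  then have "(deriv (deriv u) has_real_derivative
     - (- ((real N - 1) / r\<^sup>2) * deriv u r + deriv (deriv u) r * ((real N - 1) / r))
        - deriv f (u r) * deriv u r) (at r)"
    by (rule has_field_derivative_transform_within_open[where S = "{0<..}"])
       (use assms in \<open>simp_all add: u''_eq\<close>)
  then show ?thesis by (simp add: algebra_simps)
qed

lemma continuous_on_u: "continuous_on {0..} u"
  unfolding continuous_on_eq_continuous_within
proof
  fix r :: real assume "r \<in> {0..}"
  then consider "r = 0" | "0 < r" by fastforce
  then show "continuous (at r within {0..}) u"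
  proof cases
    case 1
    have "(u has_real_derivative 0) (at 0 within {0..})"
      using sol by (simp add: radial_solution_def)
    then show ?thesis using 1 DERIV_continuous by blast
  next
    case 2
    then show ?thesis
      using DERIV_u[OF 2] DERIV_isCont continuous_at_imp_continuous_at_within by blast
  qed
qed

lemma continuous_on_u': "continuous_on {0<..} (deriv u)"
  and continuous_on_u'': "continuous_on {0<..} (deriv (deriv u))"
  by (rule DERIV_continuous_on, rule has_field_derivative_at_within, rule DERIV_u' DERIV_u'', simp)+

section \<open>Behaviour of the solution at the singular point r = 0\<close>

lemma u_tendsto: "(u \<longlongrightarrow> \<alpha>) (at_right 0)"
proof -
  have "(u \<longlongrightarrow> u 0) (at 0 within {0..})"
    using continuous_on_u unfolding continuous_on_def by simp
  then have "(u \<longlongrightarrow> u 0) (at_right 0)"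
    by (rule tendsto_within_subset) auto
  then show ?thesis by (simp add: u_0)
qed

lemma u_quotient_tendsto: "((\<lambda>r. (u r - \<alpha>) / r) \<longlongrightarrow> 0) (at_right 0)"
proof -
  have "((\<lambda>r. (u r - u 0) / (r - 0)) \<longlongrightarrow> 0) (at 0 within {0..})"
    using sol unfolding radial_solution_def has_field_derivative_iff by blast
  then have "((\<lambda>r. (u r - u 0) / (r - 0)) \<longlongrightarrow> 0) (at_right 0)"
    by (rule tendsto_within_subset) auto
  then show ?thesis by (simp add: u_0)
qed

text \<open>Up to the area of the unit sphere, the flux of the gradient through the sphere of radius
  r. In terms of it the equation is in divergence form, without the singular coefficient
  1/r.\<close>

definition flux :: "real \<Rightarrow> real" where
  "flux r = r ^ (N - 1) * deriv u r"

lemma DERIV_flux: assumes "0 < r"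
  shows "(flux has_real_derivative - (r ^ (N - 1) * f (u r))) (at r)"
proof -
  have "((\<lambda>r. r ^ (N - 1) * deriv u r) has_real_derivative
    r ^ (N - 1) * ((real N - 1) / r) * deriv u r + deriv (deriv u) r * r ^ (N - 1)) (at r)"
    by (intro DERIV_mult DERIV_power_pred DERIV_u' assms) (use N in simp)
  then show ?thesis
    unfolding flux_def by (simp add: u''_eq[OF assms] algebra_simps)
qed

text \<open>The mean value theorem on \<open>[0, s]\<close> gives points near \<open>0\<close> where \<open>u'\<close> is small; the
  divergence form of the equation then controls the flux everywhere near \<open>0\<close>.\<close>

lemma flux_tendsto: "(flux \<longlongrightarrow> 0) (at_right 0)"
proof -
  have "continuous_on {0..1} (\<lambda>r. f (u r))"
    by (intro continuous_intros continuous_on_subset[OF continuous_on_u]) auto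
  then have "bounded ((\<lambda>r. f (u r)) ` {0..1})"
    using compact_continuous_image compact_imp_bounded by blast
  then obtain M where M: "\<And>r. r \<in> {0..1} \<Longrightarrow> \<bar>f (u r)\<bar> \<le> M"
    unfolding bounded_real by blast
  have bound: "\<bar>flux r\<bar> \<le> M * r" if r: "0 < r" "r < 1" for r
  proof (rule field_le_epsilon)
    fix e :: real assume "0 < e"
    have "eventually (\<lambda>s. \<bar>(u s - \<alpha>) / s\<bar> < e) (at_right 0)"
      using tendstoD[OF u_quotient_tendsto \<open>0 < e\<close>] by (simp add: dist_real_def)
    then obtain \<delta> where \<delta>: "0 < \<delta>" "\<And>s. 0 < s \<Longrightarrow> s < \<delta> \<Longrightarrow> \<bar>(u s - \<alpha>) / s\<bar> < e"
      unfolding eventually_at_right_field by auto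
    define s where "s = min r (\<delta> / 2)"
    have s: "0 < s" "s \<le> r" "s < \<delta>" using r \<delta>(1) by (auto simp: s_def)
    have "continuous_on {0..s} u"
      by (rule continuous_on_subset[OF continuous_on_u]) auto
    moreover have "u differentiable (at x)" if "0 < x" for x
      using DERIV_u[OF that] real_differentiable_def by blast
    ultimately obtain l z where z: "0 < z" "z < s" "DERIV u z :> l" "u s - u 0 = (s - 0) * l"
      using MVT[OF s(1), of u] by blast
    have "deriv u z = (u s - \<alpha>) / s"
      using z s(1) by (simp add: DERIV_imp_deriv u_0)
    then have "\<bar>deriv u z\<bar> < e" using \<delta>(2) s by simp
    moreover have "z ^ (N - 1) \<le> 1" "0 \<le> z ^ (N - 1)"
      using z s r by (auto intro!: power_le_one)
    ultimately have fz: "\<bar>flux z\<bar> \<le> e"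
      unfolding flux_def abs_mult
      using mult_mono[of "\<bar>z ^ (N - 1)\<bar>" 1 "\<bar>deriv u z\<bar>" e] by simp
    have "z < r" using z s by simp
    then obtain y where y: "z < y" "y < r" "flux r - flux z = (r - z) * - (y ^ (N - 1) * f (u y))"
      using MVT2[of z r flux "\<lambda>y. - (y ^ (N - 1) * f (u y))"] DERIV_flux z by auto
    have "y ^ (N - 1) \<le> 1" "0 \<le> y ^ (N - 1)"
      using z y r by (auto intro!: power_le_one)
    then have "\<bar>y ^ (N - 1) * f (u y)\<bar> \<le> M"
      unfolding abs_mult using mult_mono[of "\<bar>y ^ (N - 1)\<bar>" 1 "\<bar>f (u y)\<bar>" M] M[of y] y z r by simp
    then have "\<bar>flux r - flux z\<bar> \<le> r * M"
      unfolding y(3) abs_mult abs_minus using y z r by (intro mult_mono) auto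
    with fz show "\<bar>flux r\<bar> \<le> M * r + e" by (simp add: mult.commute)
  qed
  show ?thesis
  proof (rule Lim_null_comparison)
    show "eventually (\<lambda>r. norm (flux r) \<le> M * r) (at_right 0)"
      unfolding eventually_at_right_field using bound by (intro exI[of _ 1]) auto
    show "((\<lambda>r. M * r) \<longlongrightarrow> 0) (at_right 0)"
      by (auto intro!: tendsto_eq_intros)
  qed
qed

text \<open>As u'/r = flux / r^N with both parts tending to 0, l'Hopital's rule leads to the
  quotient -f(u)/N, whose limit is known.\<close>

lemma u'_quotient_tendsto: "((\<lambda>r. deriv u r / r) \<longlongrightarrow> - (f \<alpha> / real N)) (at_right 0)"
proof -
  have pos: "eventually (\<lambda>r::real. 0 < r) (at_right 0)"
    by (simp add: eventually_at_filter)
  have fu: "((\<lambda>r. f (u r)) \<longlongrightarrow> f \<alpha>) (at_right 0)"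
    by (rule isCont_tendsto_compose[OF DERIV_isCont[OF DERIV_f] u_tendsto])
  have "((\<lambda>r. - (r ^ (N - 1) * f (u r)) / (real N * r ^ (N - 1))) \<longlongrightarrow> - (f \<alpha> / real N)) (at_right 0)"
  proof (rule Lim_transform_eventually)
    show "((\<lambda>r. - (f (u r) / real N)) \<longlongrightarrow> - (f \<alpha> / real N)) (at_right 0)"
      by (intro tendsto_intros fu) (use N in simp)
    show "eventually (\<lambda>r. - (f (u r) / real N) = - (r ^ (N - 1) * f (u r)) / (real N * r ^ (N - 1))) (at_right 0)"
      using pos by eventually_elim simp
  qed
  then have "((\<lambda>r. flux r / r ^ N) \<longlongrightarrow> - (f \<alpha> / real N)) (at_right 0)"
  proof (rule lhopital_right_0[OF flux_tendsto, rotated -1])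
    show "((\<lambda>r::real. r ^ N) \<longlongrightarrow> 0) (at_right 0)"
      using N by (auto intro!: tendsto_eq_intros)
    show "eventually (\<lambda>r::real. r ^ N \<noteq> 0) (at_right 0)"
      using pos by eventually_elim simp
    show "eventually (\<lambda>r::real. real N * r ^ (N - 1) \<noteq> 0) (at_right 0)"
      using pos by eventually_elim (use N in simp)
    show "eventually (\<lambda>r. (flux has_real_derivative - (r ^ (N - 1) * f (u r))) (at r)) (at_right 0)"
      using pos by eventually_elim (rule DERIV_flux)
    show "eventually (\<lambda>r::real. ((\<lambda>r. r ^ N) has_real_derivative real N * r ^ (N - 1)) (at r)) (at_right 0)"
      using DERIV_pow[of N] by simp
  qed
  then show ?thesis
  proof (rule Lim_transform_eventually)
    show "eventually (\<lambda>r. flux r / r ^ N = deriv u r / r) (at_right 0)"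
      using pos
    proof eventually_elim
      case (elim r)
      have "r ^ N = r ^ (N - 1) * r"
        using N by (cases N) auto
      then show ?case using elim by (simp add: flux_def)
    qed
  qed
qed

text \<open>The previous limit inserted in the equation leaves ((N-1)/N - 1) f(\<alpha>). That u''
  and u'/r share their limit makes the Hessian of u(|x|) continuous at the origin.\<close>

lemma u''_tendsto: "(deriv (deriv u) \<longlongrightarrow> - (f \<alpha> / real N)) (at_right 0)"
proof (rule Lim_transform_eventually)
  have fu: "((\<lambda>r. f (u r)) \<longlongrightarrow> f \<alpha>) (at_right 0)"
    by (rule isCont_tendsto_compose[OF DERIV_isCont[OF DERIV_f] u_tendsto])
  have "((\<lambda>r. - ((real N - 1) * (deriv u r / r)) - f (u r)) \<longlongrightarrow>
      - ((real N - 1) * - (f \<alpha> / real N)) - f \<alpha>) (at_right 0)"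
    by (intro tendsto_intros fu u'_quotient_tendsto)
  moreover have "- ((real N - 1) * - (f \<alpha> / real N)) - f \<alpha> = - (f \<alpha> / real N)"
    using N by (simp add: field_simps)
  ultimately show "((\<lambda>r. - ((real N - 1) * (deriv u r / r)) - f (u r)) \<longlongrightarrow> - (f \<alpha> / real N)) (at_right 0)"
    by simp
  show "eventually (\<lambda>r. - ((real N - 1) * (deriv u r / r)) - f (u r) = deriv (deriv u) r) (at_right 0)"
    by (simp add: eventually_at_filter u''_eq)
qed

text \<open>With k = u'/r and l = (u'' - u'/r)/r^2, the gradient of u(|x|) is k x and the Hessian is
  k times the identity plus l times the matrix of the x_i x_j; its trace is u'' + (N-1) u'/r. At the
  origin k has the limit \<kappa>, and smallness of r^2 l suffices because |x_i x_j| \<le>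
  |x|^2.\<close>

lemma entire_solution_radial:
  assumes CARD: "CARD('n::finite) = N"
  shows "entire_solution f (\<lambda>x :: real^'n. u (norm x))"
proof -
  define \<kappa> where "\<kappa> = - (f \<alpha> / real N)"
  define k where "k r = (if r = 0 then \<kappa> else deriv u r / r)" for r
  define l where "l r = (deriv (deriv u) r - deriv u r / r) / r\<^sup>2" for r
  define G where "G x = k (norm x) *\<^sub>R x" for x :: "real^'n"
  define J where "J x = (\<chi> i j. k (norm x) * (if i = j then 1 else 0) + l (norm x) * (x $ j * x $ i))"
    for x :: "real^'n"

  have k_tendsto: "(k \<longlongrightarrow> \<kappa>) (at_right 0)"
    unfolding \<kappa>_def
    by (rule Lim_transform_eventually[OF u'_quotient_tendsto]) (simp add: k_def eventually_at_filter)
  have k_norm_tendsto: "((\<lambda>x. k (norm x)) \<longlongrightarrow> \<kappa>) (at (0 :: real^'n))"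
    by (rule filterlim_compose[OF k_tendsto filterlim_norm_at_right_0])

  have GD: "GDERIV (\<lambda>x. u (norm x)) x :> G x" for x :: "real^'n"
  proof (cases "x = 0")
    case True
    have "((\<lambda>h :: real^'n. (u (norm h) - \<alpha>) / norm h) \<longlongrightarrow> 0) (at 0)"
      by (rule filterlim_compose[OF u_quotient_tendsto filterlim_norm_at_right_0])
    then have "((\<lambda>h :: real^'n. \<bar>u (norm h) - \<alpha>\<bar> / norm h) \<longlongrightarrow> 0) (at 0)"
      using tendsto_rabs_zero[of "\<lambda>h :: real^'n. (u (norm h) - \<alpha>) / norm h"] by (simp add: abs_divide)
    then have "((\<lambda>x :: real^'n. u (norm x)) has_derivative (\<lambda>h. 0)) (at 0)"
      by (simp add: has_derivative_at u_0)
    then show ?thesis by (simp add: gderiv_def G_def True)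
  next
    case False
    have "GDERIV (\<lambda>x. u (norm x)) x :> deriv u (norm x) *\<^sub>R sgn x"
      using False by (intro GDERIV_DERIV_compose GDERIV_norm DERIV_u) auto
    then show ?thesis using False by (simp add: G_def k_def sgn_div_norm divide_inverse)
  qed
  have grad: "gradient (\<lambda>x. u (norm x)) = G"
    using gradient_eq[OF GD] by blast

  have DG: "(G has_derivative (\<lambda>h. k (norm x) *\<^sub>R h + (l (norm x) * inner h x) *\<^sub>R x)) (at x)" for x
  proof (cases "x = 0")
    case True
    have "((\<lambda>h :: real^'n. \<bar>k (norm h) - \<kappa>\<bar>) \<longlongrightarrow> 0) (at 0)"
      using tendsto_rabs_zero[OF LIM_zero[OF k_norm_tendsto]] .
    then have "((\<lambda>h :: real^'n. norm (G (0 + h) - G 0 - \<kappa> *\<^sub>R h) / norm h) \<longlongrightarrow> 0) (at 0)"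
      by (rule Lim_transform_eventually)
         (simp add: eventually_at_filter G_def scaleR_diff_left[symmetric])
    then have "(G has_derivative (\<lambda>h. \<kappa> *\<^sub>R h)) (at 0)"
      unfolding has_derivative_at by (simp add: bounded_linear_scaleR_right)
    then show ?thesis by (simp add: True k_def)
  next
    case False
    define r where "r = norm x"
    have "0 < r" using False by (simp add: r_def)
    have "((\<lambda>r. deriv u r / r) has_real_derivative l r * r) (at r)"
      using DERIV_divide[OF DERIV_u'[OF \<open>0 < r\<close>] DERIV_ident] \<open>0 < r\<close>
      by (simp add: l_def power2_eq_square divide_simps)
    then have "(k has_real_derivative l r * r) (at r)"
      by (rule has_field_derivative_transform_within_open[where S = "{0<..}"])
         (use \<open>0 < r\<close> in \<open>simp_all add: k_def\<close>)
    then have "GDERIV (\<lambda>x. k (norm x)) x :> (l r * r) *\<^sub>R sgn x"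
      unfolding r_def by (rule GDERIV_DERIV_compose[OF GDERIV_norm[OF False]])
    then have "((\<lambda>x. k (norm x)) has_derivative (\<lambda>h. l r * inner h x)) (at x)"
      using False by (simp add: gderiv_def sgn_div_norm r_def mult.assoc)
    from has_derivative_scaleR[OF this has_derivative_ident] show ?thesis
      unfolding G_def r_def by (simp add: add.commute)
  qed
  have jac: "jacobian G (at x) = J x" for x
  proof -
    have "frechet_derivative G (at x) = (\<lambda>h. k (norm x) *\<^sub>R h + (l (norm x) * inner h x) *\<^sub>R x)"
      using frechet_derivative_at[OF DG] by simp
    moreover have "axis j (1::real) $ i = (if i = j then 1 else 0)" for i j :: 'n
      by (simp add: axis_def)
    moreover have "inner (axis j 1) x = x $ j" for j
      by (simp add: inner_axis')
    ultimately show ?thesis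
      unfolding jacobian_def matrix_def J_def by (simp add: vec_eq_iff)
  qed

  have k_cont: "isCont (\<lambda>x. k (norm x)) x" for x :: "real^'n"
  proof (cases "x = 0")
    case True
    then show ?thesis using k_norm_tendsto by (simp add: isCont_def k_def)
  next
    case False
    have "continuous_on (- {0}) (\<lambda>x :: real^'n. deriv u (norm x) / norm x)"
      by (intro continuous_intros continuous_on_compose2[OF continuous_on_u']) auto
    then have "continuous_on (- {0}) (\<lambda>x :: real^'n. k (norm x))"
      using continuous_on_cong[of "- {0}" "- {0}" "\<lambda>x :: real^'n. k (norm x)" "\<lambda>x. deriv u (norm x) / norm x"]
      by (simp add: k_def)
    then show ?thesis using False by (simp add: continuous_on_eq_continuous_at open_Compl)
  qed
  have l_cont: "isCont (\<lambda>x. l (norm x) * (x $ j * x $ i)) x" for x :: "real^'n" and i j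
  proof (cases "x = 0")
    case True
    have "((\<lambda>r. deriv (deriv u) r - deriv u r / r) \<longlongrightarrow> \<kappa> - \<kappa>) (at_right 0)"
      unfolding \<kappa>_def by (intro tendsto_intros u''_tendsto u'_quotient_tendsto)
    then have "((\<lambda>r. \<bar>deriv (deriv u) r - deriv u r / r\<bar>) \<longlongrightarrow> 0) (at_right 0)"
      by (intro tendsto_rabs_zero) simp
    then have lim: "((\<lambda>x :: real^'n. \<bar>deriv (deriv u) (norm x) - deriv u (norm x) / norm x\<bar>) \<longlongrightarrow> 0) (at 0)"
      by (rule filterlim_compose[OF _ filterlim_norm_at_right_0])
    have "((\<lambda>x :: real^'n. l (norm x) * (x $ j * x $ i)) \<longlongrightarrow> 0) (at 0)"
    proof (rule Lim_null_comparison[OF always_eventually lim], rule allI)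
      fix x :: "real^'n"
      have "\<bar>x $ j * x $ i\<bar> \<le> (norm x)\<^sup>2"
        unfolding abs_mult power2_eq_square by (intro mult_mono component_le_norm_cart) auto
      then have "\<bar>l (norm x)\<bar> * \<bar>x $ j * x $ i\<bar> \<le> \<bar>l (norm x)\<bar> * (norm x)\<^sup>2"
        by (rule mult_left_mono) simp
      also have "\<dots> \<le> \<bar>deriv (deriv u) (norm x) - deriv u (norm x) / norm x\<bar>"
        by (cases "x = 0") (simp_all add: l_def abs_divide)
      finally show "norm (l (norm x) * (x $ j * x $ i)) \<le> \<bar>deriv (deriv u) (norm x) - deriv u (norm x) / norm x\<bar>"
        by (simp add: abs_mult)
    qed
    then show ?thesis using True by (simp add: isCont_def)
  next
    case False
    have "continuous_on (- {0}) (\<lambda>x :: real^'n. l (norm x) * (x $ j * x $ i))"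
      unfolding l_def
      by (intro continuous_intros continuous_on_compose2[OF continuous_on_u']
            continuous_on_compose2[OF continuous_on_u'']) auto
    then show ?thesis using False by (simp add: continuous_on_eq_continuous_at open_Compl)
  qed
  have J_cont: "continuous_on UNIV J"
    unfolding J_def
    by (intro continuous_on_vec_lambda continuous_at_imp_continuous_on ballI
          continuous_add continuous_mult continuous_const k_cont l_cont)

  have "C2 (\<lambda>x :: real^'n. u (norm x))"
    unfolding C2_def C1_def grad jac
  proof (intro conjI allI J_cont)
    show "(\<lambda>x :: real^'n. u (norm x)) differentiable at x" for x
      using GD[of x] by (auto simp: gderiv_def differentiable_def)
    show dG: "G differentiable at x" for x
      using DG[of x] by (auto simp: differentiable_def)
    then show "continuous_on UNIV G"
      by (simp add: continuous_at_imp_continuous_on differentiable_imp_continuous_within)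
  qed
  moreover have "laplacian (\<lambda>x :: real^'n. u (norm x)) x + f (u (norm x)) = 0" for x
  proof -
    have "(norm x)\<^sup>2 = (\<Sum>i\<in>UNIV. x $ i * x $ i)"
      by (simp add: power2_norm_eq_inner inner_vec_def)
    then have "laplacian (\<lambda>x :: real^'n. u (norm x)) x = real N * k (norm x) + l (norm x) * (norm x)\<^sup>2"
      unfolding laplacian_def grad jac trace_def J_def CARD[symmetric]
      by (simp add: sum.distrib sum_distrib_left)
    moreover have "real N * k r + l r * r\<^sup>2 + f (u r) = 0" if "0 \<le> r" for r
    proof (cases "r = 0")
      case True
      then show ?thesis using N by (simp add: k_def \<kappa>_def u_0)
    next
      case False
      then have "0 < r" using that by simp
      then show ?thesis
        by (simp add: k_def l_def u''_eq field_simps)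
    qed
    ultimately show ?thesis by simp
  qed
  ultimately show ?thesis
    by (simp add: entire_solution_def)
qed

end

section \<open>Instability\<close>

text \<open>Monotonicity started at a singular end: H r \<le> H s \<le> h s for small s, and h s
  tends to 0. The majorant h permits dropping a negative term of H whose limit at 0 is
  unknown.\<close>

lemma nonpos_of_DERIV_nonpos:
  fixes H h :: "real \<Rightarrow> real"
  assumes H: "\<And>s. 0 < s \<Longrightarrow> s \<le> r \<Longrightarrow> \<exists>y. (H has_real_derivative y) (at s) \<and> y \<le> 0"
    and h: "\<And>s. 0 < s \<Longrightarrow> s \<le> r \<Longrightarrow> H s \<le> h s" "(h \<longlongrightarrow> 0) (at_right 0)"
    and "0 < r"
  shows "H r \<le> 0"
proof (rule tendsto_lowerbound[OF h(2)])
  have "H r \<le> h s" if "0 < s" "s < r" for s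
  proof -
    have "H r \<le> H s"
      by (rule DERIV_nonpos_imp_nonincreasing) (use that H in auto)
    also have "\<dots> \<le> h s" using h(1) that by simp
    finally show ?thesis .
  qed
  then show "eventually (\<lambda>s. H r \<le> h s) (at_right 0)"
    unfolding eventually_at_right_field using \<open>0 < r\<close> by blast
qed simp

lemma continuous_pos_lower_bound:
  fixes h :: "real \<Rightarrow> real"
  assumes "a \<le> b" "continuous_on {a..b} h" "\<And>r. r \<in> {a..b} \<Longrightarrow> 0 < h r"
  obtains m where "0 < m" "\<And>r. r \<in> {a..b} \<Longrightarrow> m \<le> h r"
  using continuous_attains_inf[of "{a..b}" h] assms by (metis atLeastatMost_empty_iff compact_Icc not_le)

lemma continuous_abs_bound:
  fixes h :: "real \<Rightarrow> real"
  assumes "continuous_on {a..b} h"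
  obtains M where "0 \<le> M" "\<And>r. r \<in> {a..b} \<Longrightarrow> \<bar>h r\<bar> \<le> M"
proof -
  have "bounded (h ` {a..b})"
    using compact_continuous_image[OF assms] compact_imp_bounded by blast
  then obtain M where M: "\<And>r. r \<in> {a..b} \<Longrightarrow> \<bar>h r\<bar> \<le> M"
    unfolding bounded_real by blast
  show thesis
    by (rule that[of "max 0 M"]) (use M in \<open>auto simp: le_max_iff_disj\<close>)
qed

section \<open>From f' F \<ge> q to a power bound\<close>

context admissible_nonlinearity
begin

text \<open>The logarithmic derivative of f F^q is (f' F - q)/(f F) \<ge> 0, so f F^q stays below
  its value \<open>exp c\<close> at b. Hence F^(1-q), with derivative (q-1)/(f F^q), has slope at
  least \<open>D\<close>; being positive, it dominates D s.\<close>

lemma power_bound_of_tail_integral: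
  assumes "1 < q" "0 < b" and q: "\<And>s. 0 < s \<Longrightarrow> s \<le> b \<Longrightarrow> q \<le> deriv f s * tail_integral f s"
  obtains C where "0 < C" "\<And>s. 0 < s \<Longrightarrow> s \<le> b \<Longrightarrow> s \<le> C * tail_integral f s powr (1 - q)"
proof -
  let ?F = "tail_integral f"
  define c where "c = ln (f b) + q * ln (?F b)"
  define D where "D = (q - 1) / exp c"
  have "0 < D" using \<open>1 < q\<close> by (simp add: D_def)
  have fF: "f s * ?F s powr q \<le> exp c" if s: "0 < s" "s \<le> b" for s
  proof -
    have "ln (f s) + q * ln (?F s) \<le> c"
      unfolding c_def
    proof (rule DERIV_nonneg_imp_nondecreasing[OF s(2)])
      fix x assume "s \<le> x" "x \<le> b"
      with s have x: "0 < x" "x \<le> b" by auto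
      have pos: "0 < f x" "0 < ?F x" using f_pos tail_integral_pos x by auto
      have "((\<lambda>s. ln (f s) + q * ln (?F s)) has_real_derivative
          1 / f x * deriv f x + q * (1 / ?F x * (- (1 / f x)))) (at x)"
        by (intro DERIV_add DERIV_cmult DERIV_chain2[OF DERIV_ln_divide] DERIV_f DERIV_tail_integral x pos)
      moreover have "1 / f x * deriv f x + q * (1 / ?F x * (- (1 / f x)))
          = (deriv f x * ?F x - q) / (f x * ?F x)"
        using pos by (simp add: field_simps)
      moreover have "0 \<le> (deriv f x * ?F x - q) / (f x * ?F x)"
        using q[OF x] pos by simp
      ultimately show "\<exists>y. ((\<lambda>s. ln (f s) + q * ln (?F s)) has_real_derivative y) (at x) \<and> 0 \<le> y"
        by metis
    qed
    then have "exp (ln (f s) + q * ln (?F s)) \<le> exp c" by simp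
    then show ?thesis
      using f_pos[OF s(1)] tail_integral_pos[OF s(1)] by (simp add: exp_add powr_def)
  qed
  have bound: "D * s - ?F s powr (1 - q) \<le> 0" if s: "0 < s" "s \<le> b" for s
  proof (rule nonpos_of_DERIV_nonpos[where H = "\<lambda>s. D * s - ?F s powr (1 - q)" and h = "\<lambda>s. D * s"])
    fix x assume x: "0 < x" "x \<le> s"
    have pos: "0 < f x" "0 < ?F x" using f_pos tail_integral_pos x by auto
    have "((\<lambda>s. D * s - ?F s powr (1 - q)) has_real_derivative
        D * 1 - (1 - q) * ?F x powr (1 - q - 1) * - (1 / f x)) (at x)"
      by (intro DERIV_diff DERIV_cmult DERIV_ident
            DERIV_chain2[OF has_real_derivative_powr] DERIV_tail_integral x pos)
    moreover have "D * 1 - (1 - q) * ?F x powr (1 - q - 1) * - (1 / f x)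
        = (q - 1) * (1 / exp c - 1 / (f x * ?F x powr q))"
      using pos by (simp add: D_def powr_minus divide_simps) (simp add: algebra_simps)
    moreover have "1 / exp c \<le> 1 / (f x * ?F x powr q)"
      using fF[of x] x s pos by (intro divide_left_mono) auto
    then have "(q - 1) * (1 / exp c - 1 / (f x * ?F x powr q)) \<le> 0"
      using \<open>1 < q\<close> by (intro mult_nonneg_nonpos) auto
    ultimately show "\<exists>y. ((\<lambda>s. D * s - ?F s powr (1 - q)) has_real_derivative y) (at x) \<and> y \<le> 0"
      by metis
  next
    show "((\<lambda>s. D * s) \<longlongrightarrow> 0) (at_right 0)"
      by (auto intro!: tendsto_eq_intros)
  qed (use s in auto)
  show thesis
  proof (rule that[of "1 / D"])
    show "s \<le> 1 / D * ?F s powr (1 - q)" if "0 < s" "s \<le> b" for s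
      using bound[OF that] \<open>0 < D\<close> by (simp add: field_simps)
  qed (use \<open>0 < D\<close> in simp)
qed

end

text \<open>The claim N - 4 > 2 sqrt (N-1) squares to (N-2)(N-10) > 0, so N = 10 is the borderline
  dimension.\<close>

lemma q_JL_gt_1: assumes "11 \<le> N" shows "1 < q_JL N"
proof -
  have N: "11 \<le> real N" using assms by simp
  have "0 < (real N - 2) * (real N - 10)" using N by (intro mult_pos_pos) auto
  then have "real N - 1 < ((real N - 4) / 2)\<^sup>2"
    by (simp add: power2_eq_square field_simps)
  then have "sqrt (real N - 1) < (real N - 4) / 2"
    using N by (intro real_less_lsqrt) auto
  then show ?thesis by (simp add: q_JL_def)
qed

section \<open>Solutions with a zero\<close>

context radial_ode
begin

lemma first_zero:
  assumes "0 \<le> r" "u r \<le> 0"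
  obtains b where "0 < b" "u b \<le> 0" "\<And>r. 0 \<le> r \<Longrightarrow> r < b \<Longrightarrow> 0 < u r"
proof -
  define S where "S = {0..} \<inter> u -` {..0}"
  have "closed S"
    unfolding S_def by (rule continuous_closed_preimage[OF continuous_on_u]) auto
  moreover have bdd: "bdd_below S" by (rule bdd_belowI[of _ 0]) (simp add: S_def)
  moreover have "r \<in> S" using assms by (simp add: S_def)
  ultimately have Inf: "Inf S \<in> S" using closed_contains_Inf by blast
  show thesis
  proof
    show "u (Inf S) \<le> 0" using Inf by (simp add: S_def)
    then have "Inf S \<noteq> 0" using u_0 \<alpha> by auto
    then show "0 < Inf S" using Inf by (simp add: S_def)
    show "0 < u r" if "0 \<le> r" "r < Inf S" for r
      using that cInf_lower[OF _ bdd, of r] by (force simp: S_def)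
  qed
qed

text \<open>Test with a cutoff of \<open>u\<close> itself, for which \<open>f(u)/u < f'(u)\<close> gives the sign; the error of the
  cutoff vanishes since \<open>u\<close> is Lipschitz at its zero.\<close>

lemma not_stable_of_zero:
  assumes CARD: "CARD('n::finite) = N" and "0 \<le> r0" "u r0 \<le> 0"
  shows "\<not> stable f (\<lambda>x :: real^'n. u (norm x))"
proof
  assume stable: "stable f (\<lambda>x :: real^'n. u (norm x))"
  obtain b where b: "0 < b" "u b \<le> 0" and pos: "\<And>r. 0 \<le> r \<Longrightarrow> r < b \<Longrightarrow> 0 < u r"
    by (rule first_zero[OF assms(2,3)], rule that)
  have u_cont: "continuous_on {x..y} u" if "0 \<le> x" for x y
    by (rule continuous_on_subset[OF continuous_on_u]) (use that in auto)
  have u'_cont: "continuous_on {b/2..b} (deriv u)"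
    by (rule continuous_on_subset[OF continuous_on_u']) (use b in auto)
  obtain A where A: "\<And>r. r \<in> {0..b} \<Longrightarrow> \<bar>u r\<bar> \<le> A" "0 \<le> A"
    by (rule continuous_abs_bound[OF u_cont[of 0 b]], simp, rule that)
  obtain K where K: "\<And>r. r \<in> {b/2..b} \<Longrightarrow> \<bar>deriv u r\<bar> \<le> K" "0 \<le> K"
    by (rule continuous_abs_bound[OF u'_cont], rule that)
  have uK: "u r \<le> K * (b - r)" if r: "b/2 \<le> r" "r < b" for r
  proof -
    have "(u has_real_derivative deriv u x) (at x)" if "r \<le> x" for x
      using DERIV_u that r b by simp
    then obtain z where z: "r < z" "z < b" "u b - u r = (b - r) * deriv u z"
      using MVT2[OF r(2), of u "deriv u"] by blast
    have "- deriv u z \<le> K" using K(1)[of z] z r by auto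
    then have "(b - r) * - deriv u z \<le> (b - r) * K"
      using r by (intro mult_left_mono) auto
    then show ?thesis using z b by (simp add: algebra_simps)
  qed
  \<comment> \<open>Minus the integrand \<open>k\<close> below where the cutoff is 1. Its minimum m
    over a fixed middle interval is chosen before e, so it beats errors of order e.\<close>
  define g where "g r = r ^ (N - 1) * ((u r * deriv f (u r) - f (u r)) * u r)" for r
  have g_pos: "0 < g r" if "0 < r" "r < b" for r
    unfolding g_def using that pos[of r] f_less_deriv_f[of "u r"] by (intro mult_pos_pos) auto
  obtain m where m: "0 < m" "\<And>r. r \<in> {b/3..b/2} \<Longrightarrow> m \<le> g r"
  proof (rule continuous_pos_lower_bound[of "b/3" "b/2" g])
    show "continuous_on {b/3..b/2} g"
      unfolding g_def by (intro continuous_intros u_cont) (use b in auto)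
    show "0 < g r" if "r \<in> {b/3..b/2}" for r
      using g_pos[of r] b that by simp
  qed (use b that in auto)
  define C where "C = 16 * A\<^sup>2 + 16 * (b ^ (N - 1) * K\<^sup>2)"
  have "0 \<le> C" using b by (simp add: C_def)
  \<comment> \<open>The bounds serve in turn to have r \<le> 1 on the inner layer, to keep
    \<open>{b/3..b/2}\<close> inside the plateau, and to make the two layer errors, together C e,
    smaller than the gain m over the length b/6.\<close>
  define e where "e = min (1/2) (min (b/6) (m * b / (12 * (C + 1))))"
  have e: "0 < e" "2 * e \<le> 1" "2 * e \<le> b / 3"
    using b m \<open>0 \<le> C\<close> by (auto simp: e_def)
  have eC: "C * e < m * (b / 6)"
  proof -
    have "e \<le> m * b / (12 * (C + 1))" by (simp add: e_def)
    then have "e * (12 * (C + 1)) \<le> m * b"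
      using \<open>0 \<le> C\<close> by (subst (asm) pos_le_divide_eq) auto
    then have "12 * (C * e) + 12 * e \<le> m * b" by (simp add: algebra_simps)
    moreover have "0 < m * b" using m b by simp
    ultimately show ?thesis using e by simp
  qed
  have ord: "e < 2 * e" "2 * e \<le> b - 2 * e" "b - 2 * e < b - e" using e b by auto
  obtain \<theta> \<theta>' where \<theta>: "\<And>r. (\<theta> has_real_derivative \<theta>' r) (at r)" "continuous_on UNIV \<theta>'"
    "\<And>r. r \<notin> {e<..<b - e} \<Longrightarrow> \<theta> r = 0" "\<And>r. r \<notin> {e<..<b - e} \<Longrightarrow> \<theta>' r = 0"
    "\<And>r. \<bar>\<theta> r\<bar> \<le> 1"
    "\<And>r. r \<in> {2 * e..b - 2 * e} \<Longrightarrow> \<theta> r = 1" "\<And>r. r \<in> {2 * e..b - 2 * e} \<Longrightarrow> \<theta>' r = 0"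
    "\<And>r. r \<in> {e..2 * e} \<Longrightarrow> \<bar>\<theta>' r\<bar> \<le> 2 / (2 * e - e)"
    "\<And>r. r \<in> {b - 2 * e..b - e} \<Longrightarrow> \<bar>\<theta>' r\<bar> \<le> 2 / (b - e - (b - 2 * e))"
    by (rule cutoff_exists[OF ord], rule that)
  \<comment> \<open>Here u is read as a solution of the linear equation with potential f(u)/u. The
    quotient requires u > 0, hence a cutoff that ends at b - e, before the zero.\<close>
  define k where "k r = r ^ (N - 1) * ((u r * \<theta>' r)\<^sup>2 + (f (u r) / u r - deriv f (u r)) * (u r * \<theta> r)\<^sup>2)" for r
  have upos: "0 < u r" if "r \<in> {e..b - e}" for r
    using that pos e by auto
  have fu: "continuous_on {e..b - e} (\<lambda>r. deriv f (u r))"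
    by (intro continuous_intros u_cont) (use e in auto)
  have "0 \<le> integral {e..b - e} k"
    unfolding k_def CARD[symmetric]
  proof (rule stable_radial_product_test[OF stable e(1) _ fu DERIV_u DERIV_u' \<theta>(1) _ \<theta>(3) \<theta>(4)])
    show "continuous_on {0<..} \<theta>'" using \<theta>(2) continuous_on_subset by blast
    fix r assume r: "r \<in> {e..b - e}"
    then show "deriv (deriv u) r + (real CARD('n) - 1) / r * deriv u r + f (u r) / u r * u r = 0"
      using upos[OF r] e by (simp add: CARD u''_eq)
  qed (use e b in auto)
  moreover have "integral {e..b - e} k \<le> 16 * A\<^sup>2 * (2 * e - e) - m * (b/2 - b/3)
      + 16 * (b ^ (N - 1) * K\<^sup>2) * (b - e - (b - 2 * e))"
  proof (rule integral_le_piecewise)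
    have k_le: "k r \<le> r ^ (N - 1) * (u r * \<theta>' r)\<^sup>2" if r: "r \<in> {e..b - e}" for r
    proof -
      have "f (u r) / u r - deriv f (u r) \<le> 0"
        using f_less_deriv_f[OF upos[OF r]] upos[OF r] by (simp add: field_simps)
      then have "(f (u r) / u r - deriv f (u r)) * (u r * \<theta> r)\<^sup>2 \<le> 0"
        by (rule mult_nonpos_nonneg) simp
      then show ?thesis
        unfolding k_def using r e by (intro mult_left_mono) auto
    qed
    have "continuous_on {e..b - e} \<theta>"
      using \<theta>(1) by (meson DERIV_isCont continuous_at_imp_continuous_on)
    then show "continuous_on {e..b - e} k"
      unfolding k_def using upos
      by (intro continuous_intros u_cont continuous_on_subset[OF \<theta>(2)]) (use e in force)+
    show "k r \<le> 16 * A\<^sup>2" if r: "r \<in> {e..2 * e}" for r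
    proof -
      have "k r \<le> r ^ (N - 1) * (u r * \<theta>' r)\<^sup>2" using k_le r ord by simp
      also have "\<dots> \<le> (2 * e)\<^sup>2 * (A * (2 / e))\<^sup>2"
      proof (rule mult_mono)
        \<comment> \<open>The factor r^2, available since N \<ge> 3 and r \<le> 1, absorbs the
          square of the slope 2/e of the cutoff.\<close>
        have "r ^ (N - 1) \<le> r ^ 2" using r e N by (intro power_decreasing) auto
        also have "\<dots> \<le> (2 * e)\<^sup>2" using r e by (intro power_mono) auto
        finally show "r ^ (N - 1) \<le> (2 * e)\<^sup>2" .
        have "\<bar>u r * \<theta>' r\<bar> \<le> A * (2 / e)"
          unfolding abs_mult using A(1)[of r] \<theta>(8)[OF r] r e b A(2) by (intro mult_mono) auto
        then show "(u r * \<theta>' r)\<^sup>2 \<le> (A * (2 / e))\<^sup>2"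
          using A(2) e by (subst power2_le_iff_abs_le) auto
      qed auto
      also have "\<dots> = 16 * A\<^sup>2" using e by (simp add: power2_eq_square)
      finally show ?thesis .
    qed
    show "k r \<le> 0" if r: "r \<in> {2 * e..b - 2 * e}" for r
      using k_le[of r] \<theta>(7)[OF r] r e by simp
    show "k r \<le> - m" if r: "r \<in> {b/3..b/2}" for r
    proof -
      have "r \<in> {2 * e..b - 2 * e}" using r e by auto
      then have "k r = r ^ (N - 1) * ((f (u r) / u r - deriv f (u r)) * (u r)\<^sup>2)"
        by (simp add: k_def \<theta>)
      also have "\<dots> = - g r"
        using pos[of r] r b by (simp add: g_def power2_eq_square field_simps)
      finally show ?thesis using m(2)[OF r] by simp
    qed
    show "k r \<le> 16 * (b ^ (N - 1) * K\<^sup>2)" if r: "r \<in> {b - 2 * e..b - e}" for r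
    proof -
      have "k r \<le> r ^ (N - 1) * (u r * \<theta>' r)\<^sup>2" using k_le r ord by simp
      also have "\<dots> \<le> b ^ (N - 1) * (K * (2 * e) * (2 / e))\<^sup>2"
      proof (rule mult_mono)
        show "r ^ (N - 1) \<le> b ^ (N - 1)" using r e b by (intro power_mono) auto
        \<comment> \<open>On this layer u itself is of order e and absorbs the slope 2/e.\<close>
        have "u r \<le> K * (b - r)" using uK r e b by auto
        also have "\<dots> \<le> K * (2 * e)" using r K(2) by (intro mult_left_mono) auto
        finally have "\<bar>u r\<bar> \<le> K * (2 * e)" using upos[of r] r ord by auto
        then have "\<bar>u r * \<theta>' r\<bar> \<le> K * (2 * e) * (2 / e)"
          unfolding abs_mult using \<theta>(9)[OF r] e K(2) by (intro mult_mono) auto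
        then show "(u r * \<theta>' r)\<^sup>2 \<le> (K * (2 * e) * (2 / e))\<^sup>2"
          using K(2) e by (subst power2_le_iff_abs_le) auto
      qed (use b in auto)
      also have "\<dots> = 16 * (b ^ (N - 1) * K\<^sup>2)" using e by (simp add: power2_eq_square)
      finally show ?thesis .
    qed
  qed (use e b in auto)
  moreover have "16 * A\<^sup>2 * (2 * e - e) - m * (b/2 - b/3)
      + 16 * (b ^ (N - 1) * K\<^sup>2) * (b - e - (b - 2 * e)) = C * e - m * (b / 6)"
    by (simp add: C_def algebra_simps)
  ultimately show False using eC by linarith
qed

end

section \<open>Positive solutions: decay and contradiction\<close>

locale positive_radial_ode = radial_ode +
  assumes u_pos: "\<And>r. 0 \<le> r \<Longrightarrow> 0 < u r"
begin

lemma flux_nonpos: assumes "0 < r" shows "flux r \<le> 0"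
proof (rule nonpos_of_DERIV_nonpos[OF _ _ flux_tendsto assms])
  fix s :: real assume s: "0 < s"
  have "- (s ^ (N - 1) * f (u s)) \<le> 0"
    using s f_pos[OF u_pos[of s]] by simp
  then show "\<exists>y. (flux has_real_derivative y) (at s) \<and> y \<le> 0"
    using DERIV_flux[OF s] by blast
qed simp

text \<open>As u decreases, f(u(s)) \<ge> f(u(r)) for s \<le> r, which bounds the integral of
  s^(N-1) f(u(s)) from below. In differential form the terms r^(N-1) f(u) cancel and f'(u) u' r^N /
  N \<le> 0 remains.\<close>

lemma flux_le: assumes "0 < r" shows "flux r + f (u r) * (r ^ N / real N) \<le> 0" (is "?H r \<le> 0")
proof (rule nonpos_of_DERIV_nonpos[where H = ?H and h = ?H])
  fix s :: real assume s: "0 < s"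
  have "((\<lambda>r. r ^ N / real N) has_real_derivative s ^ (N - 1)) (at s)"
    using N by (auto intro!: derivative_eq_intros)
  from DERIV_add[OF DERIV_flux[OF s] DERIV_mult[OF DERIV_f_u[OF s] this]]
  have "(?H has_real_derivative deriv f (u s) * deriv u s * (s ^ N / real N)) (at s)"
    by (simp add: mult.commute)
  moreover have "s ^ (N - 1) * deriv u s \<le> s ^ (N - 1) * 0"
    using flux_nonpos[OF s] by (simp add: flux_def)
  then have "deriv u s \<le> 0"
    by (rule mult_left_le_imp_le) (use s in simp)
  then have "deriv f (u s) * deriv u s * (s ^ N / real N) \<le> 0"
    using deriv_f_pos[OF u_pos[of s]] s by (intro mult_nonpos_nonneg mult_nonneg_nonpos) auto
  ultimately show "\<exists>y. (?H has_real_derivative y) (at s) \<and> y \<le> 0" by blast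
next
  have "((\<lambda>r. f (u r)) \<longlongrightarrow> f \<alpha>) (at_right 0)"
    by (rule isCont_tendsto_compose[OF DERIV_isCont[OF DERIV_f] u_tendsto])
  moreover have "((\<lambda>r::real. r ^ N / real N) \<longlongrightarrow> 0) (at_right 0)"
    using N by (auto intro!: tendsto_eq_intros)
  ultimately show "(?H \<longlongrightarrow> 0) (at_right 0)"
    using tendsto_add[OF flux_tendsto tendsto_mult] by fastforce
qed (use assms in auto)

lemma u'_le: assumes "0 < r" shows "deriv u r \<le> - (f (u r) * (r / real N))"
proof -
  have "r ^ N = r ^ (N - 1) * r"
    using N by (cases N) auto
  then have "r ^ (N - 1) * deriv u r \<le> r ^ (N - 1) * - (f (u r) * (r / real N))"
    using flux_le[OF assms] by (simp add: flux_def algebra_simps)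
  then show ?thesis by (rule mult_left_le_imp_le) (use assms in simp)
qed

lemma u'_neg: assumes "0 < r" shows "deriv u r < 0"
proof -
  have "0 < f (u r) * (r / real N)"
    using assms N f_pos[OF u_pos[of r]] by simp
  then show ?thesis using u'_le[OF assms] by linarith
qed

text \<open>Division of the bound on u' by f(u) says that F(u(r)) has derivative -u'/f(u) \<ge> r/N;
  integrate from 0, where F(u) is positive.\<close>

lemma tail_integral_u_ge: assumes "0 < r" shows "r\<^sup>2 / (2 * real N) \<le> tail_integral f (u r)"
proof -
  let ?H = "\<lambda>r. r\<^sup>2 / (2 * real N) - tail_integral f (u r)"
  have "?H r \<le> 0"
  proof (rule nonpos_of_DERIV_nonpos[where H = ?H and h = "\<lambda>r. r\<^sup>2 / (2 * real N)"])
    fix s :: real assume s: "0 < s"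
    have fu: "0 < f (u s)" using f_pos u_pos s by simp
    have "((\<lambda>r. r\<^sup>2 / (2 * real N)) has_real_derivative s / real N) (at s)"
      using N by (auto intro!: derivative_eq_intros)
    moreover have "((\<lambda>r. tail_integral f (u r)) has_real_derivative - (1 / f (u s)) * deriv u s) (at s)"
      using DERIV_chain2[OF DERIV_tail_integral DERIV_u[OF s]] u_pos s by simp
    ultimately have "(?H has_real_derivative s / real N - - (1 / f (u s)) * deriv u s) (at s)"
      by (rule DERIV_diff)
    moreover have "s / real N - - (1 / f (u s)) * deriv u s \<le> 0"
      using u'_le[OF s] fu N by (simp add: field_simps)
    ultimately show "\<exists>y. (?H has_real_derivative y) (at s) \<and> y \<le> 0" by blast
  next
    show "?H s \<le> s\<^sup>2 / (2 * real N)" if "0 < s" for s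
      using tail_integral_pos[OF u_pos[of s]] that by simp
    show "((\<lambda>r. r\<^sup>2 / (2 * real N)) \<longlongrightarrow> 0) (at_right 0)"
      using N by (auto intro!: tendsto_eq_intros)
  qed (use assms in auto)
  then show ?thesis by simp
qed

text \<open>The mean value theorem on [r, 2r] gives a point z with |u'(z)| \<le> u(r)/r. The flux is
  nonincreasing and negative, so going back from z to r costs at most (z/r)^(N-1) \<le>
  2^(N-1).\<close>

lemma abs_u'_le: assumes "0 < r" shows "\<bar>deriv u r\<bar> \<le> 2 ^ (N - 1) * (u r / r)"
proof -
  have "(u has_real_derivative deriv u x) (at x)" if "r \<le> x" for x
    using DERIV_u assms that by simp
  moreover have "r < 2 * r" using assms by simp
  ultimately obtain z where z: "r < z" "z < 2 * r" "u (2 * r) - u r = (2 * r - r) * deriv u z"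
    using MVT2[of r "2 * r" u "deriv u"] by blast
  have "flux z \<le> flux r"
  proof (rule DERIV_nonpos_imp_nonincreasing[of r z flux])
    fix x assume "r \<le> x"
    then have x: "0 < x" using assms by simp
    then have "- (x ^ (N - 1) * f (u x)) \<le> 0"
      using f_pos[OF u_pos[of x]] by simp
    then show "\<exists>y. (flux has_real_derivative y) (at x) \<and> y \<le> 0"
      using DERIV_flux[OF x] by blast
  qed (use z in simp)
  then have "r ^ (N - 1) * - deriv u r \<le> z ^ (N - 1) * - deriv u z"
    by (simp add: flux_def)
  also have "\<dots> \<le> (2 * r) ^ (N - 1) * - deriv u z"
    using z assms u'_neg[of z] by (intro mult_right_mono power_mono) auto
  also have "\<dots> = r ^ (N - 1) * (2 ^ (N - 1) * - deriv u z)"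
    by (simp add: power_mult_distrib mult_ac)
  finally have "- deriv u r \<le> 2 ^ (N - 1) * - deriv u z"
    by (rule mult_left_le_imp_le) (use assms in simp)
  moreover have "- deriv u z = (u r - u (2 * r)) / r"
    using z(3) assms by (simp add: field_simps)
  then have "- deriv u z \<le> u r / r"
    using u_pos[of "2 * r"] assms by (simp add: divide_right_mono)
  then have "2 ^ (N - 1) * - deriv u z \<le> 2 ^ (N - 1) * (u r / r)"
    by (intro mult_left_mono) auto
  ultimately show ?thesis using u'_neg[OF assms] by linarith
qed

text \<open>As 1 - q < 0, the lower bound r^2/(2N) for F(u) turns into an upper bound of order
  r^(2-2q) for u. Passing to u' costs a factor 1/r, and squaring gives 2 - 4q.\<close>

lemma u'_decay:
  assumes "1 < q" "q < q0"
    and lim: "((\<lambda>s. deriv f s * tail_integral f s) \<longlongrightarrow> q0) (at_right 0)"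
  obtains C R where "0 < C" "0 < R" "\<And>r. R \<le> r \<Longrightarrow> (deriv u r)\<^sup>2 \<le> C * r powr (2 - 4 * q)"
proof -
  have "eventually (\<lambda>s. q < deriv f s * tail_integral f s) (at_right 0)"
    using order_tendstoD(1)[OF lim \<open>q < q0\<close>] .
  then obtain b' where b': "0 < b'" "\<And>s. 0 < s \<Longrightarrow> s < b' \<Longrightarrow> q < deriv f s * tail_integral f s"
    unfolding eventually_at_right_field by blast
  define b where "b = b' / 2"
  have b: "0 < b" using b' by (simp add: b_def)
  have bq: "q \<le> deriv f s * tail_integral f s" if "0 < s" "s \<le> b" for s
    using b' that by (intro less_imp_le b'(2)) (auto simp: b_def)
  obtain C1 where C1: "0 < C1" "\<And>s. 0 < s \<Longrightarrow> s \<le> b \<Longrightarrow> s \<le> C1 * tail_integral f s powr (1 - q)"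
    by (rule power_bound_of_tail_integral[OF \<open>1 < q\<close> b bq], assumption, assumption, rule that)
  \<comment> \<open>Chosen so that R^2/(2N) = F(b) + 1: beyond R this forces F(u) > F(b), hence u
    \<le> b, where the power bound is valid.\<close>
  define R where "R = sqrt (2 * real N * (tail_integral f b + 1))"
  define C2 where "C2 = 2 ^ (N - 1) * (C1 * (1 / (2 * real N)) powr (1 - q))"
  have Npos: "0 < real N" using N by simp
  have "0 < R" using Npos tail_integral_pos[OF b] by (simp add: R_def)
  have "0 < C2" using C1 Npos by (simp add: C2_def)
  show thesis
  proof (rule that[of "C2\<^sup>2" R])
    fix r assume "R \<le> r"
    with \<open>0 < R\<close> have r: "0 < r" by simp
    have "R\<^sup>2 \<le> r\<^sup>2" using \<open>R \<le> r\<close> \<open>0 < R\<close> by (intro power_mono) auto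
    then have "tail_integral f b + 1 \<le> r\<^sup>2 / (2 * real N)"
      using Npos tail_integral_pos[OF b] by (simp add: R_def field_simps)
    also have "\<dots> \<le> tail_integral f (u r)" by (rule tail_integral_u_ge[OF r])
    finally have "tail_integral f b < tail_integral f (u r)" by simp
    then have "u r \<le> b"
      using tail_integral_strict_antimono[OF b, of "u r"] by (meson not_less order_less_asym')
    have p: "r powr (2 * (1 - q)) = (r\<^sup>2) powr (1 - q)"
      using r by (simp add: powr_powr flip: powr_numeral)
    have "u r \<le> C1 * tail_integral f (u r) powr (1 - q)"
      using C1(2) u_pos r \<open>u r \<le> b\<close> by simp
    also have "\<dots> \<le> C1 * (r\<^sup>2 / (2 * real N)) powr (1 - q)"
      using C1(1) tail_integral_u_ge[OF r] \<open>1 < q\<close> r Npos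
      by (intro mult_left_mono powr_mono2') auto
    also have "(r\<^sup>2 / (2 * real N)) powr (1 - q) = (1 / (2 * real N)) powr (1 - q) * r powr (2 * (1 - q))"
      unfolding p using powr_mult[of "1 / (2 * real N)" "r\<^sup>2" "1 - q"] Npos by simp
    finally have ur: "u r \<le> C1 * ((1 / (2 * real N)) powr (1 - q) * r powr (2 * (1 - q)))" .
    have "\<bar>deriv u r\<bar> \<le> 2 ^ (N - 1) * (u r / r)"
      by (rule abs_u'_le[OF r])
    also have "\<dots> \<le> 2 ^ (N - 1) * (C1 * ((1 / (2 * real N)) powr (1 - q) * r powr (2 * (1 - q))) / r)"
      using ur r by (intro mult_left_mono divide_right_mono) auto
    also have "\<dots> = C2 * (r powr (2 * (1 - q)) / r)"
      by (simp add: C2_def)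
    also have "r powr (2 * (1 - q)) / r = r powr (1 - 2 * q)"
      using r powr_diff[of r "2 * (1 - q)" 1] by (simp add: algebra_simps)
    finally have "\<bar>deriv u r\<bar>\<^sup>2 \<le> (C2 * r powr (1 - 2 * q))\<^sup>2"
      by (rule power_mono) simp
    also have "\<dots> = C2\<^sup>2 * r powr (2 - 4 * q)"
      using r by (simp add: power_mult_distrib power2_eq_square flip: powr_add)
    finally show "(deriv u r)\<^sup>2 \<le> C2\<^sup>2 * r powr (2 - 4 * q)" by simp
  qed (use \<open>0 < R\<close> \<open>0 < C2\<close> in auto)
qed

text \<open>Boundedness of u'/r near 0 follows from its limit; the 1 in \<open>K\<close> leaves room
  above it. The factor r^2 will compensate the singular weight r^(-2a-2) of the inner layer.\<close>

lemma u'_square_le_near_0: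
  obtains C \<delta> where "0 < C" "0 < \<delta>" "\<And>r. 0 < r \<Longrightarrow> r < \<delta> \<Longrightarrow> (deriv u r)\<^sup>2 \<le> C * r\<^sup>2"
proof -
  define K where "K = \<bar>f \<alpha> / real N\<bar> + 1"
  have "eventually (\<lambda>r. \<bar>deriv u r / r\<bar> < K) (at_right 0)"
    using order_tendstoD(2)[OF tendsto_rabs[OF u'_quotient_tendsto], of K] by (simp add: K_def)
  then obtain \<delta> where \<delta>: "0 < \<delta>" "\<And>r. 0 < r \<Longrightarrow> r < \<delta> \<Longrightarrow> \<bar>deriv u r / r\<bar> < K"
    unfolding eventually_at_right_field by blast
  show thesis
  proof (rule that[of "K\<^sup>2" \<delta>])
    fix r :: real assume r: "0 < r" "r < \<delta>"
    have "\<bar>deriv u r\<bar> \<le> K * r"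
      using \<delta>(2)[OF r] r by (simp add: abs_divide field_simps)
    then have "\<bar>deriv u r\<bar>\<^sup>2 \<le> (K * r)\<^sup>2" by (rule power_mono) simp
    then show "(deriv u r)\<^sup>2 \<le> K\<^sup>2 * r\<^sup>2" by (simp add: power_mult_distrib)
  qed (use \<delta> in \<open>auto simp: K_def add_nonneg_eq_0_iff\<close>)
qed

text \<open>Test with a cutoff of \<open>r\<^bsup>-a\<^esup> u'\<close>: the main term is negative for \<open>a < sqrt (N - 1)\<close>, and for \<open>a\<close>
  close to \<open>sqrt (N - 1)\<close> the decay of \<open>u'\<close> makes the errors at \<open>0\<close> and at infinity negligible.\<close>

lemma not_stable:
  assumes CARD: "CARD('n::finite) = N" and "11 \<le> N" "q_JL N < q0"
    and lim: "((\<lambda>s. deriv f s * tail_integral f s) \<longlongrightarrow> q0) (at_right 0)"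
  shows "\<not> stable f (\<lambda>x :: real^'n. u (norm x))"
proof
  assume stable: "stable f (\<lambda>x :: real^'n. u (norm x))"
  \<comment> \<open>The gap is spent twice: q = q_JL + \<delta> lowers the exponent at infinity by
    4\<delta>, a = \<sigma> - \<delta> raises it by 2\<delta>, which leaves -1 - 2\<delta> in
    \<open>expo\<close>. Half the gap keeps q < q0, and \<delta> \<le> 1 keeps a > 0 because
    \<sigma> \<ge> 2.\<close>
  define \<delta> where "\<delta> = min 1 ((q0 - q_JL N) / 2)"
  have \<delta>: "0 < \<delta>" "\<delta> \<le> 1" "q_JL N + \<delta> < q0"
    using assms(3) by (auto simp: \<delta>_def min_def field_simps)
  define q where "q = q_JL N + \<delta>"
  define \<sigma> where "\<sigma> = sqrt (real N - 1)"
  define a where "a = \<sigma> - \<delta>"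
  have \<sigma>: "\<sigma>\<^sup>2 = real N - 1" "2 \<le> \<sigma>"
    using \<open>11 \<le> N\<close> by (auto simp: \<sigma>_def intro!: real_le_rsqrt)
  \<comment> \<open>The last part holds since 2a < 2\<sigma> \<le> \<sigma>^2 = N - 1; it bounds
    r^(N-1-2a) by 1 on the inner layer.\<close>
  have a: "0 < a" "a < \<sigma>" "0 \<le> real N - 1 - 2 * a"
    using \<sigma> \<delta> mult_right_mono[of 2 \<sigma> \<sigma>] by (auto simp: a_def power2_eq_square)
  have a2: "a\<^sup>2 < real N - 1"
    unfolding \<sigma>(1)[symmetric] using a by (intro power_strict_mono) auto
  have expo: "real N - 1 + (2 - 4 * q) + (- 2 * a - 2) = - 1 - 2 * \<delta>"
    by (simp add: q_def q_JL_def a_def \<sigma>_def field_simps)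
  have q: "1 < q" "q < q0"
    using q_JL_gt_1[OF \<open>11 \<le> N\<close>] \<delta> by (auto simp: q_def)

  obtain C0 \<rho> where C0: "0 < C0" "0 < \<rho>" "\<And>r. 0 < r \<Longrightarrow> r < \<rho> \<Longrightarrow> (deriv u r)\<^sup>2 \<le> C0 * r\<^sup>2"
    by (rule u'_square_le_near_0, rule that)
  obtain C1 R1 where C1: "0 < C1" "0 < R1" "\<And>r. R1 \<le> r \<Longrightarrow> (deriv u r)\<^sup>2 \<le> C1 * r powr (2 - 4 * q)"
    by (rule u'_decay[OF q lim], rule that)
  \<comment> \<open>Bounds (r \<theta>' - a \<theta>)^2 by 2 (r \<theta>')^2 + 2 (a \<theta>)^2,
    with |r \<theta>'| \<le> 4 and |\<theta>| \<le> 1.\<close>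
  define L where "L = 2 * a\<^sup>2 + 32"
  have "0 < L" by (simp add: L_def add_nonneg_pos)
  \<comment> \<open>Minus the integrand \<open>k\<close> below on the plateau, where \<eta> =
    r^(-a): \<eta>'^2 contributes a^2/r^2 against the Hardy term (N-1)/r^2. The interval
    \<open>{1..2}\<close> is fixed before e and R.\<close>
  define g where "g r = r ^ (N - 1) * ((deriv u r)\<^sup>2 * (r powr - a)\<^sup>2 * ((real N - 1 - a\<^sup>2) / r\<^sup>2))" for r
  have g_pos: "0 < g r" if "0 < r" for r
    unfolding g_def using that a2 u'_neg[of r] by (intro mult_pos_pos divide_pos_pos) auto
  obtain m where m: "0 < m" "\<And>r. r \<in> {1..2} \<Longrightarrow> m \<le> g r"
  proof (rule continuous_pos_lower_bound[of 1 2 g])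
    show "continuous_on {1..2} g"
      unfolding g_def
      by (intro continuous_intros continuous_on_subset[OF continuous_on_u']) auto
  qed (use g_pos that in auto)

  define e where "e = min (1/2) (min (\<rho> / 4) (m / (4 * (C0 * L))))"
  have e: "0 < e" "2 * e \<le> 1" "2 * e < \<rho>" "C0 * L * e < m / 2"
  proof -
    have "e \<le> m / (4 * (C0 * L))" by (simp add: e_def)
    then have "C0 * L * e \<le> m / 4"
      using C0(1) \<open>0 < L\<close> by (simp add: field_simps)
    then show "C0 * L * e < m / 2" using m(1) by simp
    have "e \<le> \<rho> / 4" "e \<le> 1 / 2" by (simp_all add: e_def)
    then show "2 * e < \<rho>" "2 * e \<le> 1" using C0(2) by auto
    show "0 < e" using C0 m \<open>0 < L\<close> by (simp add: e_def)
  qed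
  \<comment> \<open>The outer layer \<open>{R..2 * R}\<close> has length R and integrand of order
    R^(-1-2\<delta>), so its error is of order R^(-2\<delta>) and can be made less than m/2.\<close>
  obtain R where R: "2 \<le> R" "R1 \<le> R" "C1 * L * R powr (- 2 * \<delta>) < m / 2"
  proof -
    have "((\<lambda>R. C1 * L * R powr (- 2 * \<delta>)) \<longlongrightarrow> C1 * L * 0) at_top"
      using \<delta> by (intro tendsto_mult tendsto_const tendsto_neg_powr filterlim_ident) auto
    then have "eventually (\<lambda>R. C1 * L * R powr (- 2 * \<delta>) < m / 2) at_top"
      using m(1) by (intro order_tendstoD(2)) auto
    then have "eventually (\<lambda>R. 2 \<le> R \<and> R1 \<le> R \<and> C1 * L * R powr (- 2 * \<delta>) < m / 2) at_top"
      using eventually_ge_at_top[of 2] eventually_ge_at_top[of R1] by eventually_elim simp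
    then show thesis
      using that eventually_happens'[OF trivial_limit_at_top_linorder] by blast
  qed
  have ord: "e < 2 * e" "2 * e \<le> R" "R < 2 * R" using e R by auto
  obtain \<theta> \<theta>' where \<theta>: "\<And>r. (\<theta> has_real_derivative \<theta>' r) (at r)" "continuous_on UNIV \<theta>'"
    "\<And>r. r \<notin> {e<..<2 * R} \<Longrightarrow> \<theta> r = 0" "\<And>r. r \<notin> {e<..<2 * R} \<Longrightarrow> \<theta>' r = 0"
    "\<And>r. \<bar>\<theta> r\<bar> \<le> 1"
    "\<And>r. r \<in> {2 * e..R} \<Longrightarrow> \<theta> r = 1" "\<And>r. r \<in> {2 * e..R} \<Longrightarrow> \<theta>' r = 0"
    "\<And>r. r \<in> {e..2 * e} \<Longrightarrow> \<bar>\<theta>' r\<bar> \<le> 2 / (2 * e - e)"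
    "\<And>r. r \<in> {R..2 * R} \<Longrightarrow> \<bar>\<theta>' r\<bar> \<le> 2 / (2 * R - R)"
    by (rule cutoff_exists[OF ord], rule that)
  define \<eta> where "\<eta> r = r powr - a * \<theta> r" for r
  define \<eta>' where "\<eta>' r = r powr - a * (\<theta>' r - a * \<theta> r / r)" for r
  have \<eta>: "(\<eta> has_real_derivative \<eta>' r) (at r)" if "0 < r" for r
  proof -
    have "((\<lambda>r. r powr - a * \<theta> r) has_real_derivative
        - a * r powr (- a - 1) * \<theta> r + \<theta>' r * r powr - a) (at r)"
      by (intro DERIV_mult has_real_derivative_powr that \<theta>(1))
    then show ?thesis
      unfolding \<eta>_def \<eta>'_def using that by (simp add: powr_diff algebra_simps)
  qed
  have \<theta>_cont: "continuous_on S \<theta>" "continuous_on S \<theta>'" for S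
    using \<theta>(1,2) by (meson DERIV_isCont continuous_at_imp_continuous_on)
      (use \<theta>(2) continuous_on_subset in blast)
  have \<eta>_cont: "continuous_on {0<..} \<eta>" "continuous_on {0<..} \<eta>'"
    unfolding \<eta>_def \<eta>'_def by (intro continuous_intros \<theta>_cont; force)+
  define P where "P r = deriv f (u r) - (real N - 1) / r\<^sup>2" for r
  define k where "k r = r ^ (N - 1) * ((deriv u r * \<eta>' r)\<^sup>2 + (P r - deriv f (u r)) * (deriv u r * \<eta> r)\<^sup>2)" for r
  have fu: "continuous_on {e..2 * R} (\<lambda>r. deriv f (u r))"
    by (intro continuous_intros continuous_on_subset[OF continuous_on_u]) (use e in auto)
  have "0 \<le> integral {e..2 * R} k"
    unfolding k_def CARD[symmetric]
  proof (rule stable_radial_product_test[OF stable e(1) _ fu DERIV_u' DERIV_u'' \<eta> \<eta>_cont(2)])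
    fix r assume "r \<in> {e..2 * R}"
    then show "- ((real N - 1) / r * deriv (deriv u) r) - (deriv f (u r) - (real N - 1) / r\<^sup>2) * deriv u r
        + (real CARD('n) - 1) / r * deriv (deriv u) r + P r * deriv u r = 0"
      by (simp add: P_def CARD)
  qed (use e R in \<open>auto simp: \<eta>_def \<eta>'_def \<theta>(3,4)\<close>)
  moreover have "integral {e..2 * R} k \<le> C0 * L * (2 * e - e) - m * (2 - 1)
      + C1 * L * R powr (- 1 - 2 * \<delta>) * (2 * R - R)"
  proof (rule integral_le_piecewise)
    have sub: "{e..2 * R} \<subseteq> {0<..}" using e by auto
    have "continuous_on {e..2 * R} (\<lambda>r. r ^ (N - 1) * ((deriv u r * \<eta>' r)\<^sup>2
        + (- ((real N - 1) / r\<^sup>2)) * (deriv u r * \<eta> r)\<^sup>2))"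
      by (intro continuous_intros continuous_on_subset[OF continuous_on_u' sub]
          continuous_on_subset[OF \<eta>_cont(1) sub] continuous_on_subset[OF \<eta>_cont(2) sub]) (use e in auto)
    then show "continuous_on {e..2 * R} k"
      by (simp add: k_def P_def)
    have pow_eq: "r ^ (N - 1) = r powr (real N - 1)" if "0 < r" for r
      using powr_realpow[OF that, of "N - 1"] N by (simp add: of_nat_diff)
    \<comment> \<open>One estimate serves both layers: each runs from a point to its double, so |r
      \<theta>'| \<le> 4 independently of the scale.\<close>
    have k_le: "k r \<le> r ^ (N - 1) * ((deriv u r)\<^sup>2 * (L * r powr (- 2 * a - 2)))"
      if r: "0 < r" "\<bar>r * \<theta>' r\<bar> \<le> 4" for r
    proof -
      have "(P r - deriv f (u r)) * (deriv u r * \<eta> r)\<^sup>2 \<le> 0"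
        using \<open>11 \<le> N\<close> by (intro mult_nonpos_nonneg) (auto simp: P_def)
      then have "k r \<le> r ^ (N - 1) * (deriv u r * \<eta>' r)\<^sup>2"
        unfolding k_def using r by (intro mult_left_mono) auto
      also have "\<dots> = r ^ (N - 1) * ((deriv u r)\<^sup>2 * (\<eta>' r)\<^sup>2)"
        by (simp add: power_mult_distrib)
      also have "\<dots> \<le> r ^ (N - 1) * ((deriv u r)\<^sup>2 * (L * r powr (- 2 * a - 2)))"
      proof (intro mult_left_mono)
        have "\<eta>' r = r powr (- a - 1) * (r * \<theta>' r - a * \<theta> r)"
          using r by (simp add: \<eta>'_def powr_diff field_simps)
        then have "(\<eta>' r)\<^sup>2 = r powr (- 2 * a - 2) * (r * \<theta>' r - a * \<theta> r)\<^sup>2"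
          by (simp add: power_mult_distrib power2_eq_square flip: powr_add)
        moreover have "(r * \<theta>' r - a * \<theta> r)\<^sup>2 \<le> L"
        proof -
          have "(x - y)\<^sup>2 \<le> 2 * x\<^sup>2 + 2 * y\<^sup>2" for x y :: real
            using zero_le_power2[of "x + y"] by (simp add: power2_eq_square algebra_simps)
          then have "(r * \<theta>' r - a * \<theta> r)\<^sup>2 \<le> 2 * (r * \<theta>' r)\<^sup>2 + 2 * (a * \<theta> r)\<^sup>2" .
          moreover have "(r * \<theta>' r)\<^sup>2 \<le> 4\<^sup>2"
            using r(2) by (subst power2_le_iff_abs_le) auto
          moreover have "(\<theta> r)\<^sup>2 \<le> 1"
            using \<theta>(5)[of r] by (simp add: abs_square_le_1)
          then have "(a * \<theta> r)\<^sup>2 \<le> a\<^sup>2"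
            using mult_left_mono[of "(\<theta> r)\<^sup>2" 1 "a\<^sup>2"] by (simp add: power_mult_distrib)
          ultimately show ?thesis by (simp add: L_def)
        qed
        ultimately show "(\<eta>' r)\<^sup>2 \<le> L * r powr (- 2 * a - 2)"
          using mult_right_mono[of "(r * \<theta>' r - a * \<theta> r)\<^sup>2" L "r powr (- 2 * a - 2)"]
          by (simp only: mult.commute powr_ge_zero)
      qed (use r in auto)
      finally show ?thesis .
    qed
    show "k r \<le> C0 * L" if r: "r \<in> {e..2 * e}" for r
    proof -
      have r0: "0 < r" "r < \<rho>" "r \<le> 1" using r e by auto
      have "\<bar>r\<bar> * \<bar>\<theta>' r\<bar> \<le> (2 * e) * (2 / e)"
        using r \<theta>(8)[OF r] e by (intro mult_mono) auto
      then have "\<bar>r * \<theta>' r\<bar> \<le> 4" using e by (simp add: abs_mult)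
      then have "k r \<le> r ^ (N - 1) * ((deriv u r)\<^sup>2 * (L * r powr (- 2 * a - 2)))"
        using k_le r0 by simp
      also have "\<dots> \<le> r ^ (N - 1) * (C0 * r\<^sup>2 * (L * r powr (- 2 * a - 2)))"
        using C0(3)[OF r0(1,2)] r0 \<open>0 < L\<close> by (intro mult_left_mono mult_right_mono) auto
      also have "\<dots> = C0 * L * r powr (real N - 1 - 2 * a)"
      proof -
        have "real N - 1 - 2 * a = (real N - 1) + (2 + (- 2 * a - 2))" by simp
        then have "r powr (real N - 1 - 2 * a) = r ^ (N - 1) * (r\<^sup>2 * r powr (- 2 * a - 2))"
          using r0 by (simp only: powr_add pow_eq[OF r0(1)] powr_numeral)
        then show ?thesis by (simp only: mult_ac)
      qed
      also have "\<dots> \<le> C0 * L * 1"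
        using C0(1) \<open>0 < L\<close> a r0 by (intro mult_left_mono powr_le1) auto
      finally show ?thesis by simp
    qed
    have k_mid: "k r = - g r" if r: "r \<in> {2 * e..R}" for r
    proof -
      have "0 < r" using r e by simp
      have eq: "\<eta>' r = r powr - a * (- a / r)" "\<eta> r = r powr - a"
        using r by (simp_all add: \<eta>_def \<eta>'_def \<theta>)
      show ?thesis
        unfolding k_def g_def P_def eq
        using \<open>0 < r\<close> by (simp add: power2_eq_square field_simps)
    qed
    show "k r \<le> 0" if r: "r \<in> {2 * e..R}" for r
      using k_mid[OF r] g_pos[of r] r e by simp
    show "k r \<le> - m" if r: "r \<in> {1..2}" for r
      using k_mid[of r] m(2)[OF r] r e R by simp
    show "k r \<le> C1 * L * R powr (- 1 - 2 * \<delta>)" if r: "r \<in> {R..2 * R}" for r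
    proof -
      have r0: "0 < r" "R1 \<le> r" using r R by auto
      have "\<bar>r\<bar> * \<bar>\<theta>' r\<bar> \<le> (2 * R) * (2 / R)"
        using r \<theta>(9)[OF r] R by (intro mult_mono) auto
      then have "\<bar>r * \<theta>' r\<bar> \<le> 4" using R by (simp add: abs_mult)
      then have "k r \<le> r ^ (N - 1) * ((deriv u r)\<^sup>2 * (L * r powr (- 2 * a - 2)))"
        using k_le r0 by simp
      also have "\<dots> \<le> r ^ (N - 1) * (C1 * r powr (2 - 4 * q) * (L * r powr (- 2 * a - 2)))"
        using C1(3)[OF r0(2)] r0 \<open>0 < L\<close> by (intro mult_left_mono mult_right_mono) auto
      also have "\<dots> = C1 * L * r powr (- 1 - 2 * \<delta>)"
      proof -
        have "r powr (- 1 - 2 * \<delta>) = r ^ (N - 1) * r powr (2 - 4 * q) * r powr (- 2 * a - 2)"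
          unfolding expo[symmetric] powr_add pow_eq[OF r0(1)] ..
        then show ?thesis by (simp only: mult_ac)
      qed
      also have "\<dots> \<le> C1 * L * R powr (- 1 - 2 * \<delta>)"
        using C1(1) \<open>0 < L\<close> \<delta> r R by (intro mult_left_mono powr_mono2') auto
      finally show ?thesis .
    qed
  qed (use e R in auto)
  moreover have "C1 * L * R powr (- 1 - 2 * \<delta>) * (2 * R - R) = C1 * L * R powr (- 2 * \<delta>)"
    using R powr_add[of R "- 1 - 2 * \<delta>" 1] by simp
  moreover have "C0 * L * (2 * e - e) - m * (2 - 1) = C0 * L * e - m"
    by simp
  ultimately show False using e(4) R(3) by linarith
qed

end

theorem theorem1p5:
  fixes f :: "real \<Rightarrow> real" and q0 \<alpha> :: real and u :: "real \<Rightarrow> real"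
  assumes "CARD('n::finite) \<ge> 11"
    and "admissible f"
    and "((\<lambda>s. deriv f s * tail_integral f s) \<longlongrightarrow> q0) (at_right 0)"
    and "q0 > q_JL CARD('n)"
    and "\<alpha> > 0"
    and "radial_solution CARD('n) f \<alpha> u"
  shows "unstable f (\<lambda>x :: real^'n. u (norm x))"
proof -
  interpret radial_ode f "CARD('n)" \<alpha> u
    by unfold_locales (use assms in auto)
  have "\<not> stable f (\<lambda>x :: real^'n. u (norm x))"
  proof (cases "\<exists>r\<ge>0. u r \<le> 0")
    case True
    then show ?thesis using not_stable_of_zero[OF refl] by blast
  next
    case False
    interpret positive_radial_ode f "CARD('n)" \<alpha> u
      by unfold_locales (use False not_le in blast)
    show ?thesis by (rule not_stable[OF refl assms(1,4,3)])
  qed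
  then show ?thesis
    \<comment> \<open>Instability includes solving the equation on the whole space, so the
      regularity at the origin enters here.\<close>
    unfolding unstable_def using entire_solution_radial[OF refl] by blast
qed

end
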